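(* There is a family of bipartite graphs $G_n=(V_n\cup U_n,E_n)$, each a valid instance of the agent's demand problem for matching-based rewards and additive costs, such that $G_n$ has $O(n^4)$ vertices and is equipped with affine weight functions $w_\alpha(e)=\alpha f_e-c_e$ ($e\in E_n$), together with a lower bound $\alpha_2>0$ and an upper bound $Q_n\in(\alpha_2,\infty)$, with the following properties: 1. For every $e\in E_n$, $f_e\ge 0$ and $c_e\ge0$. 2. For every $S\subseteq E_n$, $f(S)\in[0,1]$. 3. For every $\alpha\in[\alpha_2,Q_n]$ and every $e\in E_n$, $w_\alpha(e)\ge0$. 4. There is $m=2^{\Omega(\log^2 n)}$ and critical values $0<\alpha_2<\dots<\alpha_m<Q_n$ such that for every $i\in\{2,\dots,m\}$, the maximum weight matching with respect to $w_{\alpha_i}$ (the agent's best response at $\alpha_i$) is a perfect matching of $G_n$, and each of these critical values has a distinct optimal matching (i.e. the optimal matchings at $\alpha_i$ and $\alpha_j$ differ for $i\ne j$).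
   Context: Matching-based rewards and additive costs: given a bipartite graph $G=(V\cup U,E)$ whose edges $e\in E$ carry a reward $f_e\ge0$ and a cost $c_e\ge0$, the actions are the edges. For $S\subseteq E$, the reward $f(S)$ is the maximum of $\sum_{e\in M}f_e$ over matchings $M\subseteq S$, and the cost is $c(S)=\sum_{e\in S}c_e$. Validity of the instance requires $f(S)\in[0,1]$ for all $S\subseteq E$. A contract is $\alpha\in[0,1]$, and the agent's utility is $u_a(\alpha,S)=\alpha f(S)-c(S)$. The agent's best response (demand) $S_\alpha$ maximizes $u_a(\alpha,\cdot)$ over all $S\subseteq E$, with ties broken in favor of sets with larger $f$ and remaining ties broken by a consistent rule independent of $\alpha$; without loss of generality $S_\alpha$ is a matching, so the agent's demand problem is that of finding a maximum weight matching with respect to edge weights $w_\alpha(e)=\alpha f_e-c_e$. Critical values are the values of $\alpha\in[0,1]$ at which the agent's demand changes: $\alpha\in(0,1]$ is critical if for every $\varepsilon>0$ there is $x\in[0,1]$ with $\alpha-\varepsilon<x<\alpha$ and $S_x\neq S_\alpha$ (by convention $0$ is also counted as critical). Asymptotics are as $n\to\infty$; $\alpha_2,\dots,\alpha_m$ and $m$ may depend on $n$. *)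

theory Defs
  imports Complex_Main "HOL-Library.Landau_Symbols"
begin

(* An undirected bipartite graph with classes left_verts and right_verts; the edge between
   v on the left and u on the right is encoded as the pair (v, u). *)
record 'v reward_graph =
  left_verts :: "'v set"
  right_verts :: "'v set"
  edges :: "('v \<times> 'v) set"
  edge_reward :: "'v \<times> 'v \<Rightarrow> real"
  edge_cost :: "'v \<times> 'v \<Rightarrow> real"

definition verts :: "'v reward_graph \<Rightarrow> 'v set" where
  "verts G = left_verts G \<union> right_verts G"

definition bipartite_graph :: "'v reward_graph \<Rightarrow> bool" where
  "bipartite_graph G \<longleftrightarrow>
     finite (left_verts G) \<and> finite (right_verts G) \<and>
     left_verts G \<inter> right_verts G = {} \<and>
     edges G \<subseteq> left_verts G \<times> right_verts G"

definition endpoints :: "'v \<times> 'v \<Rightarrow> 'v set" where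
  "endpoints e = {fst e, snd e}"

definition matching :: "('v \<times> 'v) set \<Rightarrow> bool" where
  "matching M \<longleftrightarrow> (\<forall>e\<in>M. \<forall>e'\<in>M. e \<noteq> e' \<longrightarrow> endpoints e \<inter> endpoints e' = {})"

definition perfect_matching :: "'v reward_graph \<Rightarrow> ('v \<times> 'v) set \<Rightarrow> bool" where
  "perfect_matching G M \<longleftrightarrow>
     M \<subseteq> edges G \<and> matching M \<and> (\<forall>v\<in>verts G. \<exists>e\<in>M. v \<in> endpoints e)"

definition reward :: "'v reward_graph \<Rightarrow> ('v \<times> 'v) set \<Rightarrow> real" where
  "reward G S = Max {\<Sum>e\<in>M. edge_reward G e | M. M \<subseteq> S \<and> matching M}"

definition cost :: "'v reward_graph \<Rightarrow> ('v \<times> 'v) set \<Rightarrow> real" where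
  "cost G S = (\<Sum>e\<in>S. edge_cost G e)"

definition nonneg_edge_data :: "'v reward_graph \<Rightarrow> bool" where
  "nonneg_edge_data G \<longleftrightarrow> (\<forall>e\<in>edges G. edge_reward G e \<ge> 0 \<and> edge_cost G e \<ge> 0)"

definition normalized_reward :: "'v reward_graph \<Rightarrow> bool" where
  "normalized_reward G \<longleftrightarrow> (\<forall>S\<subseteq>edges G. reward G S \<in> {0..1})"

definition valid_instance :: "'v reward_graph \<Rightarrow> bool" where
  "valid_instance G \<longleftrightarrow> bipartite_graph G \<and> nonneg_edge_data G \<and> normalized_reward G"

definition agent_utility :: "'v reward_graph \<Rightarrow> real \<Rightarrow> ('v \<times> 'v) set \<Rightarrow> real" where
  "agent_utility G \<alpha> S = \<alpha> * reward G S - cost G S"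

definition best_responses :: "'v reward_graph \<Rightarrow> real \<Rightarrow> ('v \<times> 'v) set set" where
  "best_responses G \<alpha> = {S. is_arg_max (agent_utility G \<alpha>) (\<lambda>T. T \<subseteq> edges G) S}"

definition favored_responses :: "'v reward_graph \<Rightarrow> real \<Rightarrow> ('v \<times> 'v) set set" where
  "favored_responses G \<alpha> = {S. is_arg_max (reward G) (\<lambda>T. T \<in> best_responses G \<alpha>) S}"

(* A consistent tie-breaking rule is a linear order on the sets of edges that does not depend
   on the contract, given here by an injective priority (higher is better). Preferring
   matchings makes the demand a matching: dropping from S the edges outside a
   reward-maximal matching in S keeps the reward and does not increase the cost. *)
definition tie_breaking :: "'v reward_graph \<Rightarrow> (('v \<times> 'v) set \<Rightarrow> nat) \<Rightarrow> bool" where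
  "tie_breaking G p \<longleftrightarrow>
     inj_on p (Pow (edges G)) \<and>
     (\<forall>S\<subseteq>edges G. \<forall>T\<subseteq>edges G. matching S \<and> \<not> matching T \<longrightarrow> p T < p S)"

definition demand ::
    "'v reward_graph \<Rightarrow> (('v \<times> 'v) set \<Rightarrow> nat) \<Rightarrow> real \<Rightarrow> ('v \<times> 'v) set" where
  "demand G p \<alpha> = arg_max p (\<lambda>S. S \<in> favored_responses G \<alpha>)"

definition critical_value ::
    "'v reward_graph \<Rightarrow> (('v \<times> 'v) set \<Rightarrow> nat) \<Rightarrow> real \<Rightarrow> bool" where
  "critical_value G p \<alpha> \<longleftrightarrow>
     \<alpha> = 0 \<or>
     \<alpha> \<in> {0<..1} \<and>
       (\<forall>\<epsilon>>0. \<exists>x\<in>{0..1}. \<alpha> - \<epsilon> < x \<and> x < \<alpha> \<and> demand G p x \<noteq> demand G p \<alpha>)"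

definition edge_weight :: "'v reward_graph \<Rightarrow> real \<Rightarrow> 'v \<times> 'v \<Rightarrow> real" where
  "edge_weight G \<alpha> e = \<alpha> * edge_reward G e - edge_cost G e"

definition max_weight_matching ::
    "'v reward_graph \<Rightarrow> ('v \<times> 'v \<Rightarrow> real) \<Rightarrow> ('v \<times> 'v) set \<Rightarrow> bool" where
  "max_weight_matching G w M \<longleftrightarrow>
     is_arg_max (\<lambda>N. \<Sum>e\<in>N. w e) (\<lambda>N. N \<subseteq> edges G \<and> matching N) M"

lemma tie_breaking_exists:
  assumes "bipartite_graph G"
  shows "\<exists>p. tie_breaking G p"
proof -
  have "finite (edges G)"
    using assms unfolding bipartite_graph_def by (meson finite_SigmaI finite_subset)
  then have "finite (Pow (edges G))" by simp
  then obtain g :: "('a \<times> 'a) set \<Rightarrow> nat" and N where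
    g: "g ` Pow (edges G) = {i. i < N}" "inj_on g (Pow (edges G))"
    using finite_imp_inj_to_nat_seg by metis
  define p where "p S = g S + (if matching S then N else 0)" for S
  have less: "g S < N" if "S \<subseteq> edges G" for S using g(1) that by blast
  have "inj_on p (Pow (edges G))"
  proof (rule inj_onI)
    fix S T assume S: "S \<in> Pow (edges G)" and T: "T \<in> Pow (edges G)" and eq: "p S = p T"
    have "g S < N" "g T < N" using S T less by auto
    with eq have "g S = g T" by (auto simp: p_def split: if_splits)
    with S T g(2) show "S = T" by (auto dest: inj_onD)
  qed
  moreover have "p T < p S" if "T \<subseteq> edges G" "matching S" "\<not> matching T" for S T
    using less[OF that(1)] that by (simp add: p_def)
  ultimately show ?thesis unfolding tie_breaking_def by blast
qed

lemma reward_attained: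
  assumes "finite S"
  obtains M where "M \<subseteq> S" "matching M" "reward G S = (\<Sum>e\<in>M. edge_reward G e)"
    "\<And>N. N \<subseteq> S \<Longrightarrow> matching N \<Longrightarrow> (\<Sum>e\<in>N. edge_reward G e) \<le> reward G S"
proof -
  let ?A = "{\<Sum>e\<in>M. edge_reward G e | M. M \<subseteq> S \<and> matching M}"
  have fin: "finite ?A"
    by (rule finite_subset[of _ "(\<lambda>M. \<Sum>e\<in>M. edge_reward G e) ` Pow S"]) (use assms in auto)
  have "matching {}" by (simp add: matching_def)
  then have "?A \<noteq> {}" by blast
  from Max_in[OF fin this] obtain M where
    "M \<subseteq> S" "matching M" "reward G S = (\<Sum>e\<in>M. edge_reward G e)"
    unfolding reward_def by blast
  moreover have "(\<Sum>e\<in>N. edge_reward G e) \<le> reward G S" if "N \<subseteq> S" "matching N" for N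
    unfolding reward_def by (rule Max_ge[OF fin]) (use that in blast)
  ultimately show ?thesis using that by blast
qed

lemma reward_matching:
  assumes "finite M" "matching M" "\<And>e. e \<in> M \<Longrightarrow> edge_reward G e \<ge> 0"
  shows "reward G M = (\<Sum>e\<in>M. edge_reward G e)"
proof -
  obtain N where N: "N \<subseteq> M" "reward G M = (\<Sum>e\<in>N. edge_reward G e)"
    "\<And>N. N \<subseteq> M \<Longrightarrow> matching N \<Longrightarrow> (\<Sum>e\<in>N. edge_reward G e) \<le> reward G M"
    using reward_attained[OF assms(1)] by metis
  have "(\<Sum>e\<in>N. edge_reward G e) \<le> (\<Sum>e\<in>M. edge_reward G e)"
    by (rule sum_mono2) (use assms N in auto)
  with N assms(2) show ?thesis by (metis antisym order_refl)
qed

lemma demand_max_weight_matching: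
  assumes valid: "valid_instance G" and tb: "tie_breaking G p" and "\<alpha> \<ge> 0"
  shows "demand G p \<alpha> \<in> favored_responses G \<alpha>"
    and "max_weight_matching G (edge_weight G \<alpha>) (demand G p \<alpha>)"
proof -
  let ?D = "demand G p \<alpha>" and ?u = "agent_utility G \<alpha>"
  have fin: "finite (edges G)"
    using valid unfolding valid_instance_def bipartite_graph_def
    by (meson finite_SigmaI finite_subset)
  have nonneg: "edge_reward G e \<ge> 0" "edge_cost G e \<ge> 0" if "e \<in> edges G" for e
    using valid that unfolding valid_instance_def nonneg_edge_data_def by auto
  have finite_sub: "finite S" if "S \<subseteq> edges G" for S using fin that finite_subset by blast
  have argmax_ex: "\<exists>S. is_arg_max h (\<lambda>S. S \<in> A) S"
    if "finite A" "A \<noteq> {}" for h :: "('a \<times> 'a) set \<Rightarrow> real" and A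
  proof -
    have "Max (h ` A) \<in> h ` A" using that by (intro Max_in) auto
    then obtain S where "S \<in> A" "h S = Max (h ` A)" by auto
    then have "is_arg_max h (\<lambda>S. S \<in> A) S"
      using that by (auto simp: is_arg_max_def not_less)
    then show ?thesis ..
  qed
  have br_sub: "best_responses G \<alpha> \<subseteq> Pow (edges G)"
    by (auto simp: best_responses_def is_arg_max_def)
  have br_fin: "finite (best_responses G \<alpha>)"
    using br_sub fin by (meson finite_Pow_iff finite_subset)
  have "best_responses G \<alpha> \<noteq> {}"
    using argmax_ex[of "Pow (edges G)" ?u] fin by (auto simp: best_responses_def)
  then obtain S0 where S0: "S0 \<in> favored_responses G \<alpha>"
    using argmax_ex[OF br_fin] by (auto simp: favored_responses_def)
  have fav_sub: "favored_responses G \<alpha> \<subseteq> best_responses G \<alpha>"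
    by (auto simp: favored_responses_def is_arg_max_def)
  then have fav_fin: "finite (favored_responses G \<alpha>)" using br_fin finite_subset by blast
  have bound: "\<forall>S. S \<in> favored_responses G \<alpha> \<longrightarrow> p S < Suc (Max (p ` favored_responses G \<alpha>))"
    using fav_fin by (simp add: less_Suc_eq_le)
  show D: "?D \<in> favored_responses G \<alpha>"
    using arg_max_nat_lemma[of "\<lambda>S. S \<in> favored_responses G \<alpha>", OF S0 bound]
    unfolding demand_def by blast
  have p_max: "p S \<le> p ?D" if "S \<in> favored_responses G \<alpha>" for S
    using arg_max_nat_lemma[of "\<lambda>S. S \<in> favored_responses G \<alpha>", OF S0 bound] that
    unfolding demand_def by blast
  have D_sub: "?D \<subseteq> edges G" using D fav_sub br_sub by blast
  have D_opt: "?u S \<le> ?u ?D" if "S \<subseteq> edges G" for S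
    using D fav_sub that by (force simp: best_responses_def is_arg_max_def not_less)
  have D_rew: "reward G S \<le> reward G ?D" if "S \<in> best_responses G \<alpha>" for S
    using D that by (force simp: favored_responses_def is_arg_max_def not_less)
  have D_match: "matching ?D"
  proof (rule ccontr)
    assume nm: "\<not> matching ?D"
    obtain M where M: "M \<subseteq> ?D" "matching M" "reward G ?D = (\<Sum>e\<in>M. edge_reward G e)"
      using reward_attained[OF finite_sub[OF D_sub]] by metis
    have M_sub: "M \<subseteq> edges G" using M D_sub by blast
    have rew: "reward G M = reward G ?D"
      using reward_matching[of M G] M M_sub finite_sub nonneg by (metis subsetD)
    have "cost G M \<le> cost G ?D"
      unfolding cost_def by (rule sum_mono2) (use M D_sub finite_sub nonneg in auto)
    then have "?u ?D \<le> ?u M" using rew by (simp add: agent_utility_def)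
    then have u: "?u S \<le> ?u M" if "S \<subseteq> edges G" for S using D_opt[OF that] by linarith
    then have "M \<in> best_responses G \<alpha>"
      using M_sub by (auto simp: best_responses_def is_arg_max_def not_less)
    then have "M \<in> favored_responses G \<alpha>"
      using D_rew rew by (auto simp: favored_responses_def is_arg_max_def not_less)
    then have "p M \<le> p ?D" by (rule p_max)
    moreover have "p ?D < p M"
      using tb nm M M_sub D_sub by (auto simp: tie_breaking_def)
    ultimately show False by simp
  qed
  have u_eq: "?u N = (\<Sum>e\<in>N. edge_weight G \<alpha> e)" if "N \<subseteq> edges G" "matching N" for N
  proof -
    have "reward G N = (\<Sum>e\<in>N. edge_reward G e)"
      using reward_matching[of N G] that finite_sub nonneg by blast
    then show ?thesis
      by (simp add: agent_utility_def cost_def edge_weight_def sum_subtractf sum_distrib_left)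
  qed
  show "max_weight_matching G (edge_weight G \<alpha>) ?D"
    unfolding max_weight_matching_def is_arg_max_def
    using D_sub D_match D_opt u_eq by (metis not_less)
qed

end

(* A matching of slope a and intercept b contributes the line 2 x a - b.  If b >= a^2 holds for all
   perfect matchings, no line exceeds the parabola x^2, and a matching with b = a^2 touches it at
   x = a only; so every touching point forces its own linear piece of the upper envelope.

   Perfect matchings encode the paths of a layered network.  Its layers hold an integer register,
   to which a path adds or subtracts digits z_v in {0..n}, where step v belongs to one of K
   significance levels.  Edge costs are quadratic in the digit and in the register, so the intercept
   of a path is a quadratic form Q(z); its slope is sum_v w_v z_v.  The program is built such that
   Q(z) = (sum_v w_v z_v)^2 whenever all steps of a level use the same digit, and such that
   disagreement within a level is penalised far more than anything finer can gain.  With n = 2^K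
   and 3^K - 1 steps the network has 2^O(K) nodes, but n^K = 2^(K^2) consistent digit choices. *)
theory Submission imports Defs "HOL-Library.Countable" begin

section \<open>Register programs\<close>

text \<open>Squared registers offer one free coefficient per step, whereas the square of the slope
  asks for a prescribed product for every pair of steps. So only totals are matched: the difference
  \<open>E\<close> of the two quadratic forms has zero row sums over every level not finer than the
  row. This makes \<open>E\<close> vanish on consistent digits. The penalty for disagreement comes
  from the subtracted square itself: between two steps of one level it leaves an entry close to
  minus the squared weight, and with zero row sums such a matrix is a weighted graph Laplacian. The
  obstacle is to prescribe the totals while every single coupling stays negligible against those
  entries. Nesting resolves it: the plus step and the minus step of the finest level cut a block
  into three copies of the coarser program, and the couplings of these copies to whatever precedes
  them telescope. The coefficients at level \<open>t\<close> are \<open>A t\<close> times a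
  difference of finer weights, hence smaller than the squared weight of level \<open>t\<close> by
  about the ratio of consecutive weights. Coarse levels must lie inside: coefficients still pending
  from enclosing levels are then small relative to the steps that see them.\<close>

type_synonym step = "nat \<times> int \<times> real"

text \<open>Level 0 is the most significant one and \<open>W t\<close> the weight of every step of level \<open>t\<close>; \<open>A t\<close>
  stands for the total weight of level \<open>t\<close>. A step consists of its level, the sign with which its
  digit enters the register, and the coefficient of the squared register after it. \<open>S\<close> and \<open>F\<close> are
  the factors (relative to \<open>A\<close>) by which the steps before and after the block are coupled to
  whatever follows them.\<close>

primrec block :: "(nat \<Rightarrow> real) \<Rightarrow> (nat \<Rightarrow> real) \<Rightarrow> nat \<Rightarrow> real \<Rightarrow> real \<Rightarrow> step list" where
  "block W A 0 S F = []"
| "block W A (Suc t) S F =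
     block W A t S (W t) @ (t, 1, (S - F) * A t) #
     block W A t (W t) (- W t) @ (t, -1, - ((S - F) * A t)) #
     block W A t (- W t) F"

text \<open>The change of the register over the list when all digits of level \<open>s\<close> are 1
  and all others 0.\<close>

primrec net :: "nat \<Rightarrow> step list \<Rightarrow> int" where
  "net s [] = 0"
| "net s (x # xs) = (if fst x = s then fst (snd x) else 0) + net s xs"

primrec gsum :: "step list \<Rightarrow> real" where
  "gsum [] = 0"
| "gsum (x # xs) = snd (snd x) + gsum xs"

text \<open>Half the derivative of the quadratic form with respect to a digit added to the register right
  before \<open>xs\<close>, when all digits of level \<open>s\<close> are 1, the others 0, and \<open>r\<close> is the register.\<close>

primrec future :: "nat \<Rightarrow> int \<Rightarrow> step list \<Rightarrow> real" where
  "future s r [] = 0"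
| "future s r (x # xs) =
     (let r' = r + (if fst x = s then fst (snd x) else 0)
      in snd (snd x) * of_int r' + future s r' xs)"

text \<open>Every step is coupled to each coarser level in proportion to that level's weight; \<open>c\<close> is the
  contribution still to come after the list.\<close>

primrec balanced ::
    "(nat \<Rightarrow> real) \<Rightarrow> (nat \<Rightarrow> real) \<Rightarrow> real \<Rightarrow> (nat \<Rightarrow> int) \<Rightarrow> step list \<Rightarrow> bool" where
  "balanced W A c r [] \<longleftrightarrow> True"
| "balanced W A c r (x # xs) \<longleftrightarrow>
     (\<forall>s<fst x. future s (r s) (x # xs) = (of_int (fst (snd x)) * W (fst x) - c) * A s) \<and>
     balanced W A c (\<lambda>s. r s + (if fst x = s then fst (snd x) else 0)) xs"

text \<open>The suffix sums of the coefficients are the individual couplings between steps. They must be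
  small compared with the squared weight, although the total couplings are prescribed.\<close>

primrec tame :: "(nat \<Rightarrow> real) \<Rightarrow> real \<Rightarrow> real \<Rightarrow> nat \<Rightarrow> step list \<Rightarrow> bool" where
  "tame W C d t [] \<longleftrightarrow> True"
| "tame W C d t (x # xs) \<longleftrightarrow>
     \<bar>gsum (x # xs) + d\<bar> \<le> real (t - fst x) * C * W (fst x) * W (Suc (fst x)) \<and> tame W C d t xs"

section \<open>Telescoping couplings and small suffix sums of a block\<close>

lemma net_append [simp]: "net s (xs @ ys) = net s xs + net s ys"
  by (induction xs) auto

lemma gsum_append [simp]: "gsum (xs @ ys) = gsum xs + gsum ys"
  by (induction xs) auto

lemma future_append [simp]:
  "future s r (xs @ ys) = future s r xs + future s (r + net s xs) ys"
  by (induction xs arbitrary: r) (auto simp: Let_def algebra_simps)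

lemma future_shift: "future s (r + d) xs = future s r xs + of_int d * gsum xs"
proof (induction xs arbitrary: r)
  case (Cons x xs)
  show ?case
    using Cons.IH[of "r + (if fst x = s then fst (snd x) else 0)"]
    by (simp add: Let_def algebra_simps)
qed auto

lemma block_levels: "x \<in> set (block W A t S F) \<Longrightarrow> fst x < t \<and> \<bar>fst (snd x)\<bar> = 1"
  by (induction t arbitrary: S F) (auto simp: less_Suc_eq)

lemma net_block [simp]: "net s (block W A t S F) = 0"
  by (induction t arbitrary: S F) auto

lemma gsum_block [simp]: "gsum (block W A t S F) = 0"
  by (induction t arbitrary: S F) auto

text \<open>Each level enters a block with two opposite coefficients, so their sum is zero and the
  register on entry has no influence. Blocks can therefore be placed between the two steps of a
  finer level without interference.\<close>

lemma future_block_shift [simp]: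
  "future s (r + d) (block W A t S F) = future s r (block W A t S F)"
  by (simp add: future_shift)

lemma future_block0: "future s r (block W A t S F) = future s 0 (block W A t S F)"
  using future_block_shift[of s 0 r W A t S F] by (simp del: future_block_shift)

text \<open>At the finest level of the block only the coefficient right after the plus step meets a
  nonzero register. At a coarser level the three copies contribute \<open>S - W t\<close>,
  \<open>2 * W t\<close> and \<open>- W t - F\<close> times \<open>A s\<close>, which
  telescopes.\<close>

lemma future_block: "s < t \<Longrightarrow> future s 0 (block W A t S F) = (S - F) * A s"
proof (induction t arbitrary: S F)
  case (Suc t)
  have out: "future t r (block W A t S F) = 0" for r S F
  proof -
    have "future t 0 xs = 0" if "\<forall>x\<in>set xs. fst x < t" for xs
      using that by (induction xs) auto
    moreover have "\<forall>x\<in>set (block W A t S F). fst x < t" using block_levels by blast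
    ultimately show ?thesis by (subst future_block0) blast
  qed
  show ?case
  proof (cases "s = t")
    case True
    then show ?thesis by (simp add: Let_def out)
  next
    case False
    then have "s < t" using Suc.prems by simp
    with False show ?thesis by (simp add: Let_def Suc.IH) (simp add: algebra_simps)
  qed
qed auto

text \<open>Seen from \<open>xs\<close>, the amount still to come is \<open>c' * A s\<close>: the
  part \<open>c' - c\<close> is delivered by \<open>ys\<close>, the rest after it.\<close>

lemma balanced_append:
  assumes "balanced W A c' r xs" "balanced W A c (\<lambda>s. r s + net s xs) ys"
    "\<And>x. x \<in> set xs \<Longrightarrow> fst x \<le> t"
    "\<And>s. s < t \<Longrightarrow> future s (r s + net s xs) ys = (c' - c) * A s"
  shows "balanced W A c r (xs @ ys)"
  using assms
proof (induction xs arbitrary: r)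
  case (Cons x xs)
  let ?r = "\<lambda>s. r s + (if fst x = s then fst (snd x) else 0)"
  have "balanced W A c ?r (xs @ ys)"
  proof (rule Cons.IH)
    show "balanced W A c' ?r xs" using Cons.prems by simp
    show "balanced W A c (\<lambda>s. ?r s + net s xs) ys" using Cons.prems by (simp add: add.assoc)
    show "future s (?r s + net s xs) ys = (c' - c) * A s" if "s < t" for s
      using Cons.prems(4)[OF that] by (simp add: add.assoc)
  qed (use Cons.prems in auto)
  moreover have "future s (r s) (x # xs @ ys) = (of_int (fst (snd x)) * W (fst x) - c) * A s"
    if s: "s < fst x" for s
  proof -
    have "s < t" using s Cons.prems(3)[of x] by simp
    have "future s (r s) (x # xs @ ys)
        = future s (r s) (x # xs) + future s (r s + net s (x # xs)) ys"
      using future_append[of s "r s" "x # xs" ys] by (simp del: future_append)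
    moreover have "future s (r s) (x # xs) = (of_int (fst (snd x)) * W (fst x) - c') * A s"
      using Cons.prems(1) s by simp
    ultimately show ?thesis
      using Cons.prems(4)[OF \<open>s < t\<close>] by (simp del: future.simps add: algebra_simps)
  qed
  ultimately show ?case by simp
qed auto

text \<open>The factors \<open>W t\<close> and \<open>- W t\<close> at the two cuts are exactly the
  couplings that the plus and the minus step need to everything after them. This dictates the
  arguments of the three recursive calls.\<close>

lemma balanced_block:
  "(\<And>s. s < t \<Longrightarrow> r s = 0) \<Longrightarrow> balanced W A F r (block W A t S F)"
proof (induction t arbitrary: r S F)
  case (Suc t)
  have r0: "r s = 0" if "s < t" for s using Suc.prems that by simp
  have le: "fst x \<le> t" if "x \<in> set (block W A t S' F')" for x S' F'
    using block_levels[OF that] by simp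
  let ?r = "\<lambda>s. r s + (if t = s then 1 else 0)"
  let ?r2 = "\<lambda>s. ?r s + (if t = s then -1 else 0)"
  have b3: "balanced W A F ?r2 (block W A t (- W t) F)" by (rule Suc.IH) (use r0 in auto)
  have f3: "future s a (block W A t (- W t) F) = (- W t - F) * A s" if "s < t" for s a
    using future_block[OF that] future_block0 by metis
  have f2: "future s a (block W A t (W t) (- W t)) = (2 * W t) * A s" if "s < t" for s a
    using future_block[OF that, of W A "W t" "- W t"] future_block0[of s a] by simp
  have b2: "balanced W A F ?r ((t, -1, - ((S - F) * A t)) # block W A t (- W t) F)"
    using b3 r0 f3 by (simp add: Let_def cong: if_cong)
  have f2': "future s (?r s) ((t, -1, - ((S - F) * A t)) # block W A t (- W t) F)
      = (- W t - F) * A s" if "s < t" for s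
    using that r0 f3 by (simp add: Let_def)
  have b1: "balanced W A F ?r (block W A t (W t) (- W t) @
      (t, -1, - ((S - F) * A t)) # block W A t (- W t) F)"
    by (rule balanced_append[where c' = "- W t" and t = t, OF Suc.IH])
      (use r0 b2 f2' le in auto)
  have f1: "future s (?r s) (block W A t (W t) (- W t) @
      (t, -1, - ((S - F) * A t)) # block W A t (- W t) F) = (W t - F) * A s" if "s < t" for s
    using f2'[OF that] f2[OF that] by (simp add: algebra_simps)
  have b0: "balanced W A F r ((t, 1, (S - F) * A t) # block W A t (W t) (- W t) @
      (t, -1, - ((S - F) * A t)) # block W A t (- W t) F)"
    using b1 r0 f1 by (simp add: Let_def cong: if_cong)
  have f0: "future s (r s) ((t, 1, (S - F) * A t) # block W A t (W t) (- W t) @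
      (t, -1, - ((S - F) * A t)) # block W A t (- W t) F) = (W t - F) * A s" if "s < t" for s
    using f1[OF that] r0[OF that] that by simp
  show ?case unfolding block.simps
    by (rule balanced_append[where c' = "W t" and t = t, OF Suc.IH])
      (use r0 b0 f0 le in auto)
qed auto

lemma tame_append:
  "tame W C (d + gsum ys) t xs \<Longrightarrow> tame W C d t ys \<Longrightarrow> tame W C d t (xs @ ys)"
  by (induction xs) (auto simp: algebra_simps)

text \<open>Inside a larger block the suffix sums shift by the pending coefficient of one more
  enclosing level. As weights decrease, that coefficient is charged to the level of the step, so the
  factor \<open>t - fst x\<close> counts enclosing levels.\<close>

lemma tame_mono:
  assumes "tame W C d t xs" "\<bar>e - d\<bar> \<le> C * W t * W (Suc t)" "\<And>x. x \<in> set xs \<Longrightarrow> fst x < t"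
    "0 \<le> C" "decseq W" "\<And>i. 0 \<le> W i"
  shows "tame W C e (Suc t) xs"
  using assms(1,3)
proof (induction xs)
  case (Cons x xs)
  have l: "fst x < t" using Cons.prems by simp
  have "\<bar>gsum (x # xs) + e\<bar> \<le> \<bar>gsum (x # xs) + d\<bar> + \<bar>e - d\<bar>" by linarith
  also have "\<dots> \<le> real (t - fst x) * C * W (fst x) * W (Suc (fst x)) + C * W t * W (Suc t)"
    using Cons.prems assms(2) by simp
  also have "C * W t * W (Suc t) \<le> C * W (fst x) * W (Suc (fst x))"
    using assms(4-6) l by (intro mult_mono mult_left_mono) (auto intro: decseqD)
  also have "real (t - fst x) * C * W (fst x) * W (Suc (fst x)) + C * W (fst x) * W (Suc (fst x))
      = real (Suc t - fst x) * C * W (fst x) * W (Suc (fst x))"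
    using l by (simp add: Suc_diff_le algebra_simps)
  finally show ?case using Cons by simp
qed auto

text \<open>The boundary factors of a block with finest level \<open>t\<close> are at most
  \<open>W (Suc t)\<close>, so its coefficient \<open>(S - F) * A t\<close> carries one weight of
  level \<open>t\<close> and one of the next finer level, not two of level \<open>t\<close>.\<close>

lemma tame_block:
  assumes "0 \<le> C" "decseq W" "\<And>i. 0 \<le> W i" "\<And>i. i < t \<Longrightarrow> 2 * A i \<le> C * W i" "\<And>i. 0 \<le> A i"
    "\<bar>S\<bar> \<le> W t" "\<bar>F\<bar> \<le> W t"
  shows "tame W C 0 t (block W A t S F)"
  using assms(4,6,7)
proof (induction t arbitrary: S F)
  case (Suc t)
  have "W (Suc t) \<le> W t" using assms(2) by (simp add: decseq_Suc_iff)
  then have SF: "\<bar>S\<bar> \<le> W t" "\<bar>F\<bar> \<le> W t" using Suc.prems by linarith+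
  have j: "\<bar>(S - F) * A t\<bar> \<le> C * W t * W (Suc t)"
  proof -
    have "\<bar>(S - F) * A t\<bar> \<le> (2 * W (Suc t)) * A t"
      unfolding abs_mult using Suc.prems assms(5)[of t] by (intro mult_mono) auto
    also have "\<dots> \<le> W (Suc t) * (C * W t)"
      using mult_left_mono[OF Suc.prems(1)[of t] assms(3)[of "Suc t"]] by (simp add: algebra_simps)
    finally show ?thesis by (simp add: algebra_simps)
  qed
  have CW: "0 \<le> C * W t * W (Suc t)" using assms(1,3) by simp
  have IH: "tame W C e (Suc t) (block W A t S' F')"
    if "\<bar>S'\<bar> \<le> W t" "\<bar>F'\<bar> \<le> W t" "\<bar>e\<bar> \<le> C * W t * W (Suc t)" for S' F' e
    by (rule tame_mono[where d = 0, OF Suc.IH])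
      (use that Suc.prems assms block_levels in auto)
  have "tame W C 0 (Suc t) (block W A t (- W t) F)" by (rule IH) (use assms(3) SF CW in auto)
  moreover have "tame W C (0 - (S - F) * A t) (Suc t) (block W A t (W t) (- W t))"
    by (rule IH) (use assms(3) j in auto)
  moreover have "tame W C 0 (Suc t) (block W A t S (W t))"
    by (rule IH) (use assms(3) SF CW in auto)
  ultimately show ?case
    unfolding block.simps using j CW
    by (intro tame_append) (auto simp del: block.simps intro!: tame_append)
qed auto

section \<open>From step lists to indexed sums\<close>

lemma balanced_nth:
  assumes "balanced W A c (\<lambda>_. 0) xs" "v \<le> length xs"
  shows "balanced W A c (\<lambda>s. net s (take v xs)) (drop v xs)"
  using assms(2)
proof (induction v)
  case (Suc v)
  have "balanced W A c (\<lambda>s. net s (take v xs)) (xs ! v # drop (Suc v) xs)"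
    using Suc Cons_nth_drop_Suc[of v xs] by simp
  then show ?case
    using Suc.prems by (simp add: take_Suc_conv_app_nth)
qed (use assms(1) in simp)

lemma tame_drop: "tame W C d t xs \<Longrightarrow> tame W C d t (drop v xs)"
proof (induction xs arbitrary: v)
  case (Cons x xs)
  then show ?case by (cases v) auto
qed auto

lemma net_take:
  "k \<le> length xs \<Longrightarrow> net s (take k xs) = (\<Sum>w<k. if fst (xs ! w) = s then fst (snd (xs ! w)) else 0)"
  by (induction k) (auto simp: take_Suc_conv_app_nth)

lemma gsum_drop: "v \<le> length xs \<Longrightarrow> gsum (drop v xs) = (\<Sum>i=v..<length xs. snd (snd (xs ! i)))"
proof (induction rule: inc_induct)
  case (step i)
  then show ?case
    using Cons_nth_drop_Suc[of i xs, symmetric] by (simp add: sum.atLeast_Suc_lessThan)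
qed auto

lemma future_drop:
  "v \<le> length xs \<Longrightarrow> future s (net s (take v xs)) (drop v xs) =
     (\<Sum>i=v..<length xs. snd (snd (xs ! i)) * of_int (net s (take (Suc i) xs)))"
proof (induction rule: inc_induct)
  case (step i)
  have "net s (take i xs) + (if fst (xs ! i) = s then fst (snd (xs ! i)) else 0) = net s (take (Suc i) xs)"
    using step by (simp add: take_Suc_conv_app_nth)
  then show ?case
    using step Cons_nth_drop_Suc[of i xs, symmetric]
    by (simp add: sum.atLeast_Suc_lessThan Let_def)
qed auto

lemma length_block: "length (block W A t S F) + 1 = 3 ^ t"
proof (induction t arbitrary: S F)
  case (Suc t)
  show ?case using Suc[of S "W t"] Suc[of "W t" "- W t"] Suc[of "- W t" F] by simp
qed auto

lemma count_block:
  "(\<Sum>x\<leftarrow>block W A t S F. if fst x = s then 1 else (0::nat)) = (if s < t then 2 * 3 ^ (t - 1 - s) else 0)"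
proof (induction t arbitrary: S F)
  case (Suc t)
  have "t - s = Suc (t - 1 - s)" if "s < t" using that by simp
  with Suc show ?case by auto
qed auto

section \<open>Quadratic forms dominated by coarse levels\<close>

lemma sum_below_level:
  fixes E :: "nat \<Rightarrow> real" and u :: "nat \<Rightarrow> real"
  assumes "\<And>s. s < l \<Longrightarrow> (\<Sum>w<T. if lev w = s then E w else 0) = 0"
  shows "(\<Sum>w<T. if lev w < l then E w * u (lev w) else 0) = 0"
proof -
  have "(\<Sum>w<T. if lev w < l then E w * u (lev w) else 0)
      = (\<Sum>w<T. \<Sum>s<l. if lev w = s then E w * u s else 0)"
    by (intro sum.cong refl) simp
  also have "\<dots> = (\<Sum>s<l. \<Sum>w<T. if lev w = s then E w * u s else 0)" by (rule sum.swap)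
  also have "\<dots> = (\<Sum>s<l. u s * (\<Sum>w<T. if lev w = s then E w else 0))"
    by (intro sum.cong refl) (auto simp: sum_distrib_left intro!: sum.cong)
  also have "\<dots> = 0" using assms by simp
  finally show ?thesis .
qed

text \<open>By symmetry every pair of steps of different levels can be charged to its finer member,
  whose row sum over the coarser level is the one that is controlled.\<close>

lemma quadratic_form_split:
  fixes E :: "nat \<Rightarrow> nat \<Rightarrow> real" and z :: "nat \<Rightarrow> real" and lev :: "nat \<Rightarrow> nat"
  assumes sym: "\<And>v w. E v w = E w v"
  shows "(\<Sum>v<T. \<Sum>w<T. E v w * z v * z w) =
    (\<Sum>v<T. z v * (\<Sum>w<T. if lev w = lev v then E v w * z w else 0)) +
    2 * (\<Sum>v<T. z v * (\<Sum>w<T. if lev w < lev v then E v w * z w else 0))"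
proof -
  let ?e = "\<lambda>v w. if lev w = lev v then E v w * z v * z w else 0"
  let ?b = "\<lambda>v w. if lev w < lev v then E v w * z v * z w else 0"
  have "(\<Sum>v<T. \<Sum>w<T. E v w * z v * z w) = (\<Sum>v<T. \<Sum>w<T. ?e v w + ?b v w + ?b w v)"
    using sym by (intro sum.cong refl) auto
  also have "\<dots> = (\<Sum>v<T. \<Sum>w<T. ?e v w) + (\<Sum>v<T. \<Sum>w<T. ?b v w) + (\<Sum>v<T. \<Sum>w<T. ?b w v)"
    by (simp add: sum.distrib)
  also have "(\<Sum>v<T. \<Sum>w<T. ?b w v) = (\<Sum>v<T. \<Sum>w<T. ?b v w)" by (rule sum.swap)
  finally show ?thesis
    by (auto simp: sum_distrib_left algebra_simps intro!: arg_cong2[where f = "(+)"] sum.cong)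
qed

lemma quadratic_form_consistent:
  fixes E :: "nat \<Rightarrow> nat \<Rightarrow> real" and lev :: "nat \<Rightarrow> nat"
  assumes sym: "\<And>v w. E v w = E w v"
    and rows: "\<And>v s. v < T \<Longrightarrow> s \<le> lev v \<Longrightarrow> (\<Sum>w<T. if lev w = s then E v w else 0) = 0"
  shows "(\<Sum>v<T. \<Sum>w<T. E v w * y (lev v) * y (lev w)) = 0"
proof -
  have "(\<Sum>w<T. if lev w = lev v then E v w * y (lev w) else 0) = 0" if "v < T" for v
  proof -
    have "(\<Sum>w<T. if lev w = lev v then E v w * y (lev w) else 0)
        = y (lev v) * (\<Sum>w<T. if lev w = lev v then E v w else 0)"
      by (auto simp: sum_distrib_left intro!: sum.cong)
    then show ?thesis using rows[OF that order_refl] by simp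
  qed
  moreover have "(\<Sum>w<T. if lev w < lev v then E v w * y (lev w) else 0) = 0" if "v < T" for v
    using rows[OF that] by (intro sum_below_level) simp
  ultimately show ?thesis
    using quadratic_form_split[where E = E and T = T and lev = lev and z = "\<lambda>v. y (lev v)", OF sym] by simp
qed

text \<open>With zero row sums the part within levels is a Laplacian, a sum of squared differences
  with nonnegative weights. For the same reason the cross part sees coarse digits only through their
  deviations \<open>d\<close> from a representative of their level. Digits are integers, so the
  linear error \<open>\<bar>d w\<bar>\<close> is at most the square of \<open>d w\<close> and is
  absorbed by the penalty.\<close>

lemma quadratic_form_nonneg:
  fixes E :: "nat \<Rightarrow> nat \<Rightarrow> real" and z :: "nat \<Rightarrow> int" and lev :: "nat \<Rightarrow> nat"
  assumes sym: "\<And>v w. E v w = E w v"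
    and rows: "\<And>v s. v < T \<Longrightarrow> s \<le> lev v \<Longrightarrow> (\<Sum>w<T. if lev w = s then E v w else 0) = 0"
    and same: "\<And>v w. v < T \<Longrightarrow> w < T \<Longrightarrow> v \<noteq> w \<Longrightarrow> lev v = lev w \<Longrightarrow> E v w \<le> - \<eta> (lev v)"
    and cross: "\<And>v w. v < T \<Longrightarrow> w < T \<Longrightarrow> lev w < lev v \<Longrightarrow> \<bar>E v w\<bar> \<le> \<epsilon> (lev w)"
    and \<epsilon>: "\<And>s. 0 \<le> \<epsilon> s" "\<And>s. 4 * real T * real n * \<epsilon> s \<le> \<eta> s"
    and z: "\<And>v. 0 \<le> z v" "\<And>v. z v \<le> int n"
  shows "0 \<le> (\<Sum>v<T. \<Sum>w<T. E v w * real_of_int (z v) * real_of_int (z w))"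
proof -
  define x where "x v = real_of_int (z v)" for v
  define r where "r s = (SOME v. v < T \<and> lev v = s)" for s
  have r: "r (lev v) < T \<and> lev (r (lev v)) = lev v" if "v < T" for v
    unfolding r_def by (rule someI[of "\<lambda>w. w < T \<and> lev w = lev v"]) (use that in simp)
  define d where "d w = x w - x (r (lev w))" for w
  define P where "P = (\<Sum>w<T. \<epsilon> (lev w) * (d w)\<^sup>2)"
  have x: "0 \<le> x v" "x v \<le> n" for v
  proof -
    show "0 \<le> x v" using z(1)[of v] by (simp add: x_def)
    have "real_of_int (z v) \<le> real_of_int (int n)" using z(2)[of v] by (simp only: of_int_le_iff)
    then show "x v \<le> n" by (simp add: x_def)
  qed
  have d: "\<bar>d w\<bar> \<le> (d w)\<^sup>2" for w
  proof -
    have i: "\<bar>i\<bar> \<le> i\<^sup>2" for i :: int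
    proof (cases "i = 0")
      case False
      then have "1 * \<bar>i\<bar> \<le> \<bar>i\<bar> * \<bar>i\<bar>" by (intro mult_right_mono) auto
      then show ?thesis by (simp add: power2_eq_square)
    qed auto
    have "real_of_int \<bar>z w - z (r (lev w))\<bar> \<le> real_of_int ((z w - z (r (lev w)))\<^sup>2)"
      using i by (simp only: of_int_le_iff)
    then show ?thesis by (simp add: d_def x_def)
  qed
  define F where "F v w = (if lev w = lev v then E v w else 0)" for v w
  have Fsym: "F v w = F w v" for v w using sym by (simp add: F_def)
  have "(\<Sum>w<T. if lev w = lev v then E v w * x w else 0) = (\<Sum>w<T. F v w * (x w - x v))"
    if v: "v < T" for v
  proof -
    have "(\<Sum>w<T. F v w * (x w - x v)) = (\<Sum>w<T. F v w * x w) - x v * (\<Sum>w<T. F v w)"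
      by (simp add: right_diff_distrib sum_subtractf sum_distrib_left mult.commute)
    also have "(\<Sum>w<T. F v w) = 0" using rows[of v "lev v"] v by (simp add: F_def)
    finally show ?thesis by (auto simp: F_def intro!: sum.cong)
  qed
  then have "(\<Sum>v<T. x v * (\<Sum>w<T. if lev w = lev v then E v w * x w else 0))
      = (\<Sum>v<T. x v * (\<Sum>w<T. F v w * (x w - x v)))"
    by (intro sum.cong refl) simp
  also have "\<dots> = (\<Sum>v<T. \<Sum>w<T. F v w * x v * (x w - x v))"
    by (simp add: sum_distrib_left algebra_simps)
  \<comment> \<open>The cross part enters the form twice, each time with at least minus
    \<open>T * (n * P)\<close>; after doubling the whole form this requires the factor 4.\<close>
  also have "2 * \<dots> \<ge> 4 * (real T * (real n * P))"
  proof -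
    let ?f = "\<lambda>v w. F v w * x v * (x w - x v)"
    have "2 * (\<Sum>v<T. \<Sum>w<T. ?f v w) = (\<Sum>v<T. \<Sum>w<T. ?f v w) + (\<Sum>w<T. \<Sum>v<T. ?f v w)"
      using sum.swap[of ?f "{..<T}" "{..<T}"] by simp
    also have "(\<Sum>w<T. \<Sum>v<T. ?f v w) = (\<Sum>v<T. \<Sum>w<T. F v w * x w * (x v - x w))"
      using Fsym by (intro sum.cong refl) auto
    also have "(\<Sum>v<T. \<Sum>w<T. ?f v w) + \<dots> = (\<Sum>w<T. \<Sum>v<T. - F v w * (x w - x v)\<^sup>2)"
      unfolding sum.distrib[symmetric] using Fsym
      by (intro sum.cong refl) (auto simp: power2_eq_square algebra_simps)
    also have "\<dots> \<ge> (\<Sum>w<T. \<eta> (lev w) * (d w)\<^sup>2)"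
    proof (rule sum_mono)
      fix w assume "w \<in> {..<T}"
      then have w: "w < T" by simp
      have \<eta>: "0 \<le> \<eta> s" for s using \<epsilon>[of s] by (meson mult_nonneg_nonneg of_nat_0_le_iff order_trans zero_le_numeral)
      have summand: "0 \<le> - F v w * (x w - x v)\<^sup>2" if "v < T" for v
      proof (cases "v = w \<or> lev v \<noteq> lev w")
        case False
        then have "F v w \<le> 0" using same[OF that w] \<eta>[of "lev v"] by (simp add: F_def)
        then show ?thesis by (simp add: mult_nonpos_nonneg)
      qed (auto simp: F_def)
      \<comment> \<open>Of all differences within the level, the one to the representative is
        enough.\<close>
      have "\<eta> (lev w) * (d w)\<^sup>2 \<le> - F (r (lev w)) w * (x w - x (r (lev w)))\<^sup>2"
      proof (cases "r (lev w) = w")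
        case False
        have "\<eta> (lev w) \<le> - F (r (lev w)) w"
          using same[of "r (lev w)" w] r[OF w] w False by (simp add: F_def)
        then show ?thesis unfolding d_def by (rule mult_right_mono) simp
      qed (simp add: d_def)
      also have "\<dots> \<le> (\<Sum>v<T. - F v w * (x w - x v)\<^sup>2)"
        by (rule member_le_sum) (use summand r[OF w] in auto)
      finally show "\<eta> (lev w) * (d w)\<^sup>2 \<le> (\<Sum>v<T. - F v w * (x w - x v)\<^sup>2)" .
    qed
    finally have "(\<Sum>w<T. \<eta> (lev w) * (d w)\<^sup>2) \<le> 2 * (\<Sum>v<T. \<Sum>w<T. ?f v w)" .
    moreover have "4 * (real T * (real n * P)) \<le> (\<Sum>w<T. \<eta> (lev w) * (d w)\<^sup>2)"
      unfolding P_def sum_distrib_left mult.assoc[symmetric]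
      using \<epsilon>(2) by (intro sum_mono mult_right_mono) (auto simp: mult.assoc)
    ultimately show ?thesis by linarith
  qed
  finally have 1: "4 * (real T * (real n * P)) \<le> 2 * (\<Sum>v<T. x v * (\<Sum>w<T. if lev w = lev v then E v w * x w else 0))" .
  have "\<bar>x v * (\<Sum>w<T. if lev w < lev v then E v w * x w else 0)\<bar> \<le> n * P" if v: "v < T" for v
  proof -
    have "(\<Sum>w<T. if lev w < lev v then E v w * x w else 0)
        = (\<Sum>w<T. if lev w < lev v then E v w * d w else 0) +
          (\<Sum>w<T. if lev w < lev v then E v w * x (r (lev w)) else 0)"
      unfolding sum.distrib[symmetric] by (intro sum.cong refl) (simp add: d_def algebra_simps)
    also have "(\<Sum>w<T. if lev w < lev v then E v w * x (r (lev w)) else 0) = 0"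
      using sum_below_level[where l = "lev v" and T = T and lev = lev and E = "E v" and u = "\<lambda>l. x (r l)"] rows[OF v] by simp
    also have "\<bar>(\<Sum>w<T. if lev w < lev v then E v w * d w else 0) + 0\<bar> \<le> P"
      unfolding P_def add_0_right
    proof (rule order_trans[OF sum_abs sum_mono])
      fix w assume w: "w \<in> {..<T}"
      show "\<bar>if lev w < lev v then E v w * d w else 0\<bar> \<le> \<epsilon> (lev w) * (d w)\<^sup>2"
      proof (cases "lev w < lev v")
        case True
        then have "\<bar>E v w\<bar> * \<bar>d w\<bar> \<le> \<epsilon> (lev w) * (d w)\<^sup>2"
          using cross[OF v] w d \<epsilon>(1) by (intro mult_mono) auto
        then show ?thesis using True by (simp add: abs_mult)
      qed (use \<epsilon>(1) in simp)
    qed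
    finally have "\<bar>\<Sum>w<T. if lev w < lev v then E v w * x w else 0\<bar> \<le> P" .
    then have "\<bar>x v\<bar> * \<bar>\<Sum>w<T. if lev w < lev v then E v w * x w else 0\<bar> \<le> n * P"
      using x[of v] by (intro mult_mono) auto
    then show ?thesis by (simp add: abs_mult)
  qed
  then have "(\<Sum>v<T. \<bar>x v * (\<Sum>w<T. if lev w < lev v then E v w * x w else 0)\<bar>) \<le> (\<Sum>v<T. n * P)"
    by (intro sum_mono) simp
  then have "\<bar>\<Sum>v<T. x v * (\<Sum>w<T. if lev w < lev v then E v w * x w else 0)\<bar> \<le> T * (n * P)"
    by (intro order_trans[OF sum_abs]) simp
  then have "- (real T * (real n * P)) \<le> (\<Sum>v<T. x v * (\<Sum>w<T. if lev w < lev v then E v w * x w else 0))"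
    by linarith
  moreover have "0 \<le> real T * (real n * P)"
    unfolding P_def using \<epsilon>(1) by (intro mult_nonneg_nonneg sum_nonneg) auto
  ultimately have "0 \<le> (\<Sum>v<T. \<Sum>w<T. E v w * x v * x w)"
    using 1 quadratic_form_split[where E = E and T = T and lev = lev and z = x, OF sym]
    by linarith
  then show ?thesis by (simp only: x_def)
qed

section \<open>Couplings produced by squared registers\<close>

lemma sum_tail_max:
  fixes g :: "nat \<Rightarrow> real"
  shows "(\<Sum>i=max v w..<T. g i) = (\<Sum>i=v..<T. if w \<le> i then g i else 0)"
proof -
  have "{max v w..<T} = {i \<in> {v..<T}. w \<le> i}" by auto
  then show ?thesis by (simp only: sum.inter_filter finite_atLeastLessThan)
qed

text \<open>Two digits meet in the register from the later of their steps on, so their coupling is a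
  suffix sum of the coefficients.\<close>

lemma sum_prefix_squares:
  fixes g f :: "nat \<Rightarrow> real"
  shows "(\<Sum>i<T. g i * (\<Sum>v\<le>i. f v)\<^sup>2) =
    (\<Sum>v<T. \<Sum>w<T. (\<Sum>i=max v w..<T. g i) * f v * f w)"
proof -
  have "(\<Sum>v<T. \<Sum>w<T. (\<Sum>i=max v w..<T. g i) * f v * f w)
      = (\<Sum>v<T. \<Sum>w<T. \<Sum>i<T. if v \<le> i \<and> w \<le> i then g i * f v * f w else 0)"
  proof (intro sum.cong refl)
    fix v w
    have eq: "{max v w..<T} = {i \<in> {..<T}. v \<le> i \<and> w \<le> i}" by auto
    have "(\<Sum>i=max v w..<T. g i) * f v * f w = (\<Sum>i=max v w..<T. g i * f v * f w)"
      by (simp only: sum_distrib_right)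
    also have "\<dots> = (\<Sum>i<T. if v \<le> i \<and> w \<le> i then g i * f v * f w else 0)"
      unfolding eq by (rule sum.inter_filter) simp
    finally show "(\<Sum>i=max v w..<T. g i) * f v * f w
        = (\<Sum>i<T. if v \<le> i \<and> w \<le> i then g i * f v * f w else 0)" .
  qed
  also have "\<dots> = (\<Sum>v<T. \<Sum>i<T. \<Sum>w<T. if v \<le> i \<and> w \<le> i then g i * f v * f w else 0)"
    by (intro sum.cong refl sum.swap)
  also have "\<dots> = (\<Sum>i<T. \<Sum>v<T. \<Sum>w<T. if v \<le> i \<and> w \<le> i then g i * f v * f w else 0)"
    by (rule sum.swap)
  also have "\<dots> = (\<Sum>i<T. g i * (\<Sum>v\<le>i. f v)\<^sup>2)"
  proof (intro sum.cong refl)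
    fix i assume i: "i \<in> {..<T}"
    then have "{..i} = {v \<in> {..<T}. v \<le> i}" by auto
    then have "(\<Sum>v\<le>i. f v) = (\<Sum>v<T. if v \<le> i then f v else 0)"
      by (simp only: sum.inter_filter finite_lessThan)
    then have "g i * (\<Sum>v\<le>i. f v)\<^sup>2
        = (\<Sum>v<T. \<Sum>w<T. g i * ((if v \<le> i then f v else 0) * (if w \<le> i then f w else 0)))"
      by (simp only: power2_eq_square sum_product) (simp only: sum_distrib_left)
    then show "(\<Sum>v<T. \<Sum>w<T. if v \<le> i \<and> w \<le> i then g i * f v * f w else 0)
        = g i * (\<Sum>v\<le>i. f v)\<^sup>2"
      by (auto intro!: sum.cong)
  qed
  finally show ?thesis by simp
qed

lemma quadratic_form_expand:
  fixes \<beta> g f w x :: "nat \<Rightarrow> real"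
  shows "(\<Sum>v<T. \<beta> v * (x v)\<^sup>2 + g v * (\<Sum>i\<le>v. f i * x i)\<^sup>2) - (\<Sum>v<T. w v * x v)\<^sup>2 =
    (\<Sum>v<T. \<Sum>u<T. (f v * f u * (\<Sum>i=max v u..<T. g i) - w v * w u + (if v = u then \<beta> v else 0)) * x v * x u)"
proof -
  define G where "G v u = (\<Sum>i=max v u..<T. g i)" for v u
  have "(\<Sum>v<T. \<Sum>u<T. (f v * f u * G v u - w v * w u + (if v = u then \<beta> v else 0)) * x v * x u)
      = (\<Sum>v<T. \<Sum>u<T. (G v u * (f v * x v) * (f u * x u) - (w v * x v) * (w u * x u))
          + (if v = u then \<beta> v * (x v)\<^sup>2 else 0))"
  proof (intro sum.cong refl)
    fix v u
    have "(f v * f u * G v u - w v * w u + b) * x v * x u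
        = G v u * (f v * x v) * (f u * x u) - (w v * x v) * (w u * x u) + b * (x v * x u)" for b
      by (simp add: algebra_simps)
    moreover have "(if v = u then \<beta> v else 0) * (x v * x u) = (if v = u then \<beta> v * (x v)\<^sup>2 else 0)"
      by (simp add: power2_eq_square)
    ultimately show "(f v * f u * G v u - w v * w u + (if v = u then \<beta> v else 0)) * x v * x u
        = G v u * (f v * x v) * (f u * x u) - (w v * x v) * (w u * x u)
          + (if v = u then \<beta> v * (x v)\<^sup>2 else 0)"
      by (simp only:)
  qed
  also have "\<dots> = (\<Sum>v<T. \<Sum>u<T. G v u * (f v * x v) * (f u * x u))
      - (\<Sum>v<T. \<Sum>u<T. (w v * x v) * (w u * x u))
      + (\<Sum>v<T. \<Sum>u<T. if v = u then \<beta> v * (x v)\<^sup>2 else 0)"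
    by (simp only: sum.distrib sum_subtractf)
  also have "(\<Sum>v<T. \<Sum>u<T. G v u * (f v * x v) * (f u * x u)) = (\<Sum>v<T. g v * (\<Sum>i\<le>v. f i * x i)\<^sup>2)"
    unfolding G_def by (rule sum_prefix_squares[symmetric])
  also have "(\<Sum>v<T. \<Sum>u<T. (w v * x v) * (w u * x u)) = (\<Sum>v<T. w v * x v)\<^sup>2"
    by (simp only: power2_eq_square sum_product)
  also have "(\<Sum>v<T. \<Sum>u<T. if v = u then \<beta> v * (x v)\<^sup>2 else 0) = (\<Sum>v<T. \<beta> v * (x v)\<^sup>2)"
    by (intro sum.cong refl) simp
  finally show ?thesis by (simp only: G_def sum.distrib)
qed

text \<open>Exchanging the sums expresses the total coupling of step \<open>v\<close> to level
  \<open>s\<close> through the register that level \<open>s\<close> alone would produce; the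
  right-hand side is \<open>future\<close> in indexed form.\<close>

lemma sum_tail_prefix:
  fixes g :: "nat \<Rightarrow> real" and \<sigma> :: "nat \<Rightarrow> int"
  shows "(\<Sum>w<T. if lev w = s then of_int (\<sigma> w) * (\<Sum>i=max v w..<T. g i) else 0) =
    (\<Sum>i=v..<T. g i * of_int (\<Sum>w<Suc i. if lev w = s then \<sigma> w else 0))"
proof -
  let ?h = "\<lambda>w i. if lev w = s \<and> w \<le> i then g i * of_int (\<sigma> w) else 0"
  have "(\<Sum>w<T. if lev w = s then of_int (\<sigma> w) * (\<Sum>i=max v w..<T. g i) else 0)
      = (\<Sum>w<T. \<Sum>i=v..<T. ?h w i)"
    unfolding sum_tail_max by (intro sum.cong refl) (auto simp: sum_distrib_left intro!: sum.cong)
  also have "\<dots> = (\<Sum>i=v..<T. \<Sum>w<T. ?h w i)" by (rule sum.swap)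
  also have "\<dots> = (\<Sum>i=v..<T. g i * of_int (\<Sum>w<Suc i. if lev w = s then \<sigma> w else 0))"
  proof (intro sum.cong refl)
    fix i assume i: "i \<in> {v..<T}"
    have "(\<Sum>w<T. ?h w i) = (\<Sum>w<Suc i. ?h w i)"
      by (rule sum.mono_neutral_right) (use i in auto)
    then show "(\<Sum>w<T. ?h w i) = g i * of_int (\<Sum>w<Suc i. if lev w = s then \<sigma> w else 0)"
      by (auto simp: sum_distrib_left of_int_sum simp del: sum.lessThan_Suc intro!: sum.cong)
  qed
  finally show ?thesis .
qed

lemma sum_by_level:
  fixes f :: "nat \<Rightarrow> 'a::comm_semiring_1" and lev :: "nat \<Rightarrow> nat" and K :: nat
  assumes "\<And>v. v < T \<Longrightarrow> lev v < K"
  shows "(\<Sum>v<T. f v * y (lev v)) = (\<Sum>t<K. y t * (\<Sum>v<T. if lev v = t then f v else 0))"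
proof -
  have "(\<Sum>v<T. f v * y (lev v)) = (\<Sum>v<T. \<Sum>t<K. if lev v = t then f v * y t else 0)"
    using assms by (intro sum.cong refl) simp
  also have "\<dots> = (\<Sum>t<K. \<Sum>v<T. if lev v = t then f v * y t else 0)" by (rule sum.swap)
  finally show ?thesis by (auto simp: sum_distrib_left mult.commute intro!: sum.cong)
qed

lemma register_program:
  fixes K n :: nat
  assumes n: "0 < n"
  obtains T :: nat and lev :: "nat \<Rightarrow> nat" and \<sigma> :: "nat \<Rightarrow> int"
    and w \<beta> g :: "nat \<Rightarrow> real" and c :: nat and q :: real
  where "T + 1 = 3 ^ K" "n \<le> c" "0 < q"
    "\<And>v. v < T \<Longrightarrow> \<bar>\<sigma> v\<bar> = 1" "\<And>v. 0 \<le> w v"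
    "\<And>y. (\<Sum>v<T. w v * y (lev v)) = q * (\<Sum>t<K. c ^ (K - 1 - t) * y t)"
    "\<And>y. (\<Sum>v<T. \<sigma> v * y (lev v)) = 0"
    "\<And>z :: nat \<Rightarrow> int. (\<And>v. 0 \<le> z v \<and> z v \<le> int n) \<Longrightarrow>
       (\<Sum>v<T. w v * z v)\<^sup>2 \<le> (\<Sum>v<T. \<beta> v * (z v)\<^sup>2 + g v * (\<Sum>i\<le>v. \<sigma> i * z i)\<^sup>2)"
    "\<And>y :: nat \<Rightarrow> int.
       (\<Sum>v<T. \<beta> v * (y (lev v))\<^sup>2 + g v * (\<Sum>i\<le>v. \<sigma> i * y (lev i))\<^sup>2) =
       (\<Sum>v<T. w v * y (lev v))\<^sup>2"
proof -
  \<comment> \<open>The ratio of consecutive weights equals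
    \<open>8 * 3 ^ K * n * (1 + K * C)\<close> with \<open>C\<close> as below. Since
    \<open>T < 3 ^ K\<close>, this is what \<open>4 * T * n * \<epsilon> s \<le> \<eta> s\<close>
    demands. The value of \<open>C\<close> comes from \<open>2 * A t \<le> C * W t\<close>.\<close>
  define \<Lambda> where "\<Lambda> = 8 * 3 ^ K * n * (1 + 4 * K * 3 ^ K)"
  define W :: "nat \<Rightarrow> real" where "W t = real \<Lambda> ^ (K - t)" for t
  define A where "A t = 2 * 3 ^ (K - 1 - t) * W t" for t
  define C :: real where "C = 4 * 3 ^ K"
  define xs where "xs = block W A K 0 0"
  define T where "T = length xs"
  define lev where "lev v = fst (xs ! v)" for v
  define \<sigma> where "\<sigma> v = fst (snd (xs ! v))" for v
  define g where "g v = snd (snd (xs ! v))" for v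
  define w where "w v = W (lev v)" for v
  define \<Gamma> where "\<Gamma> v = (\<Sum>i=v..<T. g i)" for v
  define H where "H s v = (\<Sum>i=v..<T. g i * of_int (\<Sum>u<Suc i. if lev u = s then \<sigma> u else 0))" for s v
  \<comment> \<open>The block settles the row sums over coarser levels; the diagonal remains to make
    the row sum over the step's own level vanish.\<close>
  define \<beta> where "\<beta> v = w v * A (lev v) - \<sigma> v * H (lev v) v" for v
  define E where "E v u = real_of_int (\<sigma> v) * real_of_int (\<sigma> u) * \<Gamma> (max v u) - w v * w u + (if v = u then \<beta> v else 0)" for v u
  have "1 \<le> (3::nat) ^ K * (n * (1 + 4 * K * 3 ^ K))" using n by simp
  then have \<Lambda>1: "1 \<le> \<Lambda>" by (simp add: \<Lambda>_def algebra_simps)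
  have T: "T + 1 = 3 ^ K" using length_block[of W A K 0 0] by (simp add: T_def xs_def)
  have W0: "0 < W t" for t using \<Lambda>1 by (simp add: W_def)
  then have W_nonneg: "0 \<le> W t" for t by (simp add: less_imp_le)
  have decW: "decseq W" unfolding decseq_Suc_iff W_def using \<Lambda>1
    by (auto intro!: power_increasing)
  have WSuc: "W (Suc t) = W t / \<Lambda>" if "t < K" for t
    using that \<Lambda>1 by (simp add: W_def Suc_diff_Suc[symmetric])
  have A0: "0 \<le> A t" for t using W0[of t] by (simp add: A_def)
  have AC: "2 * A t \<le> C * W t" for t
  proof -
    have "(3::real) ^ (K - 1 - t) \<le> 3 ^ K" by (intro power_increasing) auto
    then show ?thesis using W0[of t] by (simp add: A_def C_def)
  qed
  have step: "\<bar>\<sigma> v\<bar> = 1 \<and> lev v < K" if "v < T" for v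
    using block_levels[of "xs ! v" W A K 0 0] that by (simp add: xs_def T_def \<sigma>_def lev_def)
  have bal: "(\<Sum>i=v..<T. g i * of_int (\<Sum>u<Suc i. if lev u = s then \<sigma> u else 0))
      = \<sigma> v * w v * A s" if v: "v < T" and s: "s < lev v" for v s
  proof -
    have "balanced W A 0 (\<lambda>s. net s (take v xs)) (drop v xs)"
      by (rule balanced_nth) (use v balanced_block in \<open>auto simp: xs_def T_def\<close>)
    then have "future s (net s (take v xs)) (drop v xs) = \<sigma> v * w v * A s"
      using Cons_nth_drop_Suc[of v xs, symmetric] v s
      by (simp add: T_def lev_def \<sigma>_def w_def del: future.simps)
    then show ?thesis
      using future_drop[of v xs s] v
      by (simp add: T_def lev_def \<sigma>_def g_def net_take del: sum.lessThan_Suc cong: if_cong)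
  qed
  have \<Gamma>: "\<bar>\<Gamma> v\<bar> \<le> K * C * (W (lev v))\<^sup>2 / \<Lambda>" if v: "v < T" for v
  proof -
    have "tame W C 0 K (drop v xs)"
      unfolding xs_def by (intro tame_drop tame_block) (use decW W_nonneg A0 AC in \<open>auto simp: C_def\<close>)
    then have "\<bar>gsum (drop v xs)\<bar> \<le> real (K - lev v) * C * W (lev v) * W (Suc (lev v))"
      using Cons_nth_drop_Suc[of v xs, symmetric] v by (simp add: T_def lev_def)
    also have "gsum (drop v xs) = \<Gamma> v"
      using v by (simp add: gsum_drop \<Gamma>_def g_def T_def)
    also have "real (K - lev v) * C * W (lev v) * W (Suc (lev v)) = real (K - lev v) * (C * (W (lev v))\<^sup>2 / \<Lambda>)"
      using WSuc step[OF v] by (simp add: power2_eq_square)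
    also have "\<dots> \<le> K * (C * (W (lev v))\<^sup>2 / \<Lambda>)"
      by (intro mult_right_mono) (auto simp: C_def)
    finally show ?thesis by simp
  qed
  have levA: "(\<Sum>v<T. if lev v = t then w v else 0) = A t" if "t < K" for t
  proof -
    have "(\<Sum>v<T. if lev v = t then w v else 0) = W t * real (\<Sum>v<T. if lev v = t then 1 else (0::nat))"
      by (auto simp: sum_distrib_left w_def intro!: sum.cong)
    also have "(\<Sum>v<T. if lev v = t then 1 else (0::nat)) = (\<Sum>x\<leftarrow>xs. if fst x = t then 1 else 0)"
      by (simp add: sum_list_sum_nth T_def lev_def atLeast0LessThan)
    also have "\<dots> = 2 * 3 ^ (K - 1 - t)" using that by (simp add: xs_def count_block)
    finally show ?thesis by (simp add: A_def)
  qed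
  have lev\<sigma>: "(\<Sum>v<T. if lev v = t then \<sigma> v else 0) = 0" for t
  proof -
    have "net t (take T xs) = 0" by (simp add: T_def) (simp add: xs_def)
    then show ?thesis using net_take[of T xs t] by (simp add: T_def lev_def \<sigma>_def cong: if_cong)
  qed
  have quad: "(\<Sum>v<T. \<beta> v * (x v)\<^sup>2 + g v * (\<Sum>i\<le>v. real_of_int (\<sigma> i) * x i)\<^sup>2) - (\<Sum>v<T. w v * x v)\<^sup>2
      = (\<Sum>v<T. \<Sum>u<T. E v u * x v * x u)" for x :: "nat \<Rightarrow> real"
    unfolding E_def \<Gamma>_def by (rule quadratic_form_expand)
  have sym: "E v u = E u v" for v u by (cases "v = u") (simp_all add: E_def max.commute[of v u] mult.commute)
  have rows: "(\<Sum>u<T. if lev u = s then E v u else 0) = 0" if v: "v < T" and s: "s \<le> lev v" for v s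
  proof -
    have sK: "s < K" using s step[OF v] by simp
    have "(\<Sum>u<T. if lev u = s then E v u else 0)
        = \<sigma> v * (\<Sum>u<T. if lev u = s then of_int (\<sigma> u) * \<Gamma> (max v u) else 0)
          - w v * (\<Sum>u<T. if lev u = s then w u else 0)
          + (\<Sum>u<T. if u = v then (if lev v = s then \<beta> v else 0) else 0)"
      unfolding sum_distrib_left sum.distrib[symmetric] sum_subtractf[symmetric]
      by (intro sum.cong refl) (auto simp: E_def)
    also have "(\<Sum>u<T. if lev u = s then of_int (\<sigma> u) * \<Gamma> (max v u) else 0) = H s v"
      unfolding \<Gamma>_def H_def by (rule sum_tail_prefix)
    also have "(\<Sum>u<T. if lev u = s then w u else 0) = A s" by (rule levA[OF sK])
    finally have eq: "(\<Sum>u<T. if lev u = s then E v u else 0)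
        = \<sigma> v * H s v - w v * A s + (if lev v = s then \<beta> v else 0)"
      using v by simp
    have \<sigma>\<sigma>: "real_of_int (\<sigma> v) * \<sigma> v = 1" using step[OF v] by (auto simp: abs_if split: if_splits)
    show ?thesis
    proof (cases "s = lev v")
      case True
      then show ?thesis using eq by (simp add: \<beta>_def)
    next
      case False
      then have "H s v = \<sigma> v * w v * A s" using bal[OF v, of s] s by (simp add: H_def)
      then have "\<sigma> v * H s v = (real_of_int (\<sigma> v) * \<sigma> v) * w v * A s" by simp
      then show ?thesis using eq False \<sigma>\<sigma> by simp
    qed
  qed
  \<comment> \<open>The summand 1 accounts for the product of two weights of different levels,
    \<open>K * C\<close> for the register coupling; both gain the factor
    \<open>1 / \<Lambda>\<close>. Within a level the register coupling takes at most half of the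
    squared weight, which leaves \<open>\<eta>\<close>.\<close>
  define \<epsilon> where "\<epsilon> s = (1 + K * C) * (W s)\<^sup>2 / \<Lambda>" for s
  define \<eta> where "\<eta> s = (W s)\<^sup>2 / 2" for s
  have \<sigma>\<Gamma>: "\<bar>\<sigma> v * \<sigma> u * \<Gamma> (max v u)\<bar> \<le> K * C * (W (lev u))\<^sup>2 / \<Lambda>"
    if v: "v < T" and u: "u < T" and le: "lev u \<le> lev v" for v u
  proof -
    have "\<bar>\<sigma> v * \<sigma> u * \<Gamma> (max v u)\<bar> = \<bar>\<Gamma> (max v u)\<bar>"
      using step[OF v] step[OF u] by (simp add: abs_mult flip: of_int_abs)
    also have "\<dots> \<le> K * C * (W (lev (max v u)))\<^sup>2 / \<Lambda>" by (rule \<Gamma>) (use v u in auto)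
    also have "\<dots> \<le> K * C * (W (lev u))\<^sup>2 / \<Lambda>"
      using le decW W0 by (intro divide_right_mono mult_left_mono power_mono)
        (use W_nonneg in \<open>auto simp: max_def C_def dest: decseqD\<close>)
    finally show ?thesis .
  qed
  have big: "8 * 3 ^ K * real n * (1 + K * C) \<le> \<Lambda>" by (simp add: \<Lambda>_def C_def algebra_simps)
  have KC: "2 * (K * C) \<le> \<Lambda>"
  proof -
    have "1 * 1 \<le> (3::real) ^ K * real n" using n by (intro mult_mono) auto
    then have "2 \<le> 8 * (3 ^ K * real n)" by linarith
    then have "2 * (1 + K * C) \<le> 8 * (3 ^ K * real n) * (1 + K * C)"
      by (intro mult_right_mono) (simp_all add: C_def)
    then have "2 * (1 + K * C) \<le> \<Lambda>" using big by (simp only: mult.assoc)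
    then show ?thesis by simp
  qed
  have same: "E v u \<le> - \<eta> (lev v)" if "v < T" "u < T" "v \<noteq> u" "lev v = lev u" for v u
  proof -
    have "E v u \<le> K * C * (W (lev v))\<^sup>2 / \<Lambda> - (W (lev v))\<^sup>2"
      using \<sigma>\<Gamma>[OF that(1,2)] that by (simp add: E_def w_def power2_eq_square abs_le_iff)
    also have "K * C * (W (lev v))\<^sup>2 / \<Lambda> \<le> (W (lev v))\<^sup>2 / 2"
      using mult_right_mono[OF KC, of "(W (lev v))\<^sup>2"] \<Lambda>1 by (simp add: field_simps)
    finally show ?thesis by (simp add: \<eta>_def)
  qed
  have cross: "\<bar>E v u\<bar> \<le> \<epsilon> (lev u)" if "v < T" "u < T" "lev u < lev v" for v u
  proof -
    have "W (lev v) \<le> W (Suc (lev u))" using that decW by (simp add: decseqD)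
    also have "\<dots> = W (lev u) / \<Lambda>" using WSuc step[OF that(2)] by simp
    finally have "W (lev v) * W (lev u) \<le> W (lev u) / \<Lambda> * W (lev u)"
      using W0[of "lev u"] by (intro mult_right_mono) auto
    moreover have "\<bar>E v u\<bar> \<le> \<bar>real_of_int (\<sigma> v) * \<sigma> u * \<Gamma> (max v u)\<bar> + W (lev v) * W (lev u)"
    proof -
      have "E v u = real_of_int (\<sigma> v) * \<sigma> u * \<Gamma> (max v u) - W (lev v) * W (lev u)"
        using that by (auto simp: E_def w_def)
      moreover have "\<bar>W (lev v) * W (lev u)\<bar> = W (lev v) * W (lev u)"
        using W_nonneg by simp
      ultimately show ?thesis by (metis abs_triangle_ineq4)
    qed
    moreover have "\<epsilon> (lev u) = K * C * (W (lev u))\<^sup>2 / \<Lambda> + W (lev u) / \<Lambda> * W (lev u)"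
      by (simp add: \<epsilon>_def power2_eq_square distrib_right add_divide_distrib)
    ultimately show ?thesis
      using \<sigma>\<Gamma>[of v u] that by simp
  qed
  have \<epsilon>0: "0 \<le> \<epsilon> s" for s by (simp add: \<epsilon>_def C_def)
  have dom: "4 * real T * real n * \<epsilon> s \<le> \<eta> s" for s
  proof -
    have "real T \<le> 3 ^ K" using T by (metis le_add1 of_nat_le_iff of_nat_numeral of_nat_power)
    then have "8 * real T * real n * (1 + K * C) \<le> 8 * 3 ^ K * real n * (1 + K * C)"
      by (intro mult_right_mono mult_left_mono) (auto simp: C_def)
    then have "8 * real T * real n * (1 + K * C) * (W s)\<^sup>2 \<le> \<Lambda> * (W s)\<^sup>2"
      using big by (intro mult_right_mono) auto
    then show ?thesis using \<Lambda>1 by (simp add: \<epsilon>_def \<eta>_def field_simps)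
  qed
  \<comment> \<open>Level \<open>t\<close> consists of \<open>2 * 3 ^ (K - 1 - t)\<close> steps of
    weight \<open>\<Lambda> ^ (K - t)\<close>. Its total weight is
    \<open>2 * \<Lambda> * (3 * \<Lambda>) ^ (K - 1 - t)\<close>, which gives the base and the scale
    of the slope.\<close>
  show ?thesis
  proof (rule that[of T "3 * \<Lambda>" "2 * real \<Lambda>" \<sigma> w lev \<beta> g])
    show "T + 1 = 3 ^ K" by (rule T)
    have "n * 1 \<le> n * (8 * 3 ^ K * (1 + 4 * K * 3 ^ K))"
      by (intro mult_left_mono) (auto simp: Suc_le_eq)
    then show "n \<le> 3 * \<Lambda>" by (simp add: \<Lambda>_def algebra_simps)
    show "0 < 2 * real \<Lambda>" using \<Lambda>1 by simp
    show "\<bar>\<sigma> v\<bar> = 1" if "v < T" for v using step[OF that] by auto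
    show "0 \<le> w v" for v using W0 by (simp add: w_def less_imp_le)
    show "(\<Sum>v<T. w v * y (lev v)) = 2 * real \<Lambda> * (\<Sum>t<K. (3 * \<Lambda>) ^ (K - 1 - t) * y t)" for y
    proof -
      have "A t = 2 * real \<Lambda> * (3 * \<Lambda>) ^ (K - 1 - t)" if "t < K" for t
      proof -
        have "K - t = Suc (K - 1 - t)" using that by simp
        then show ?thesis by (simp add: A_def W_def power_mult_distrib)
      qed
      then show ?thesis
        using step levA by (subst sum_by_level[where K = K]) (auto simp: sum_distrib_left intro!: sum.cong)
    qed
    show "(\<Sum>v<T. \<sigma> v * y (lev v)) = 0" for y
      using step lev\<sigma> by (subst sum_by_level[where K = K]) auto
    show "(\<Sum>v<T. w v * z v)\<^sup>2 \<le> (\<Sum>v<T. \<beta> v * (z v)\<^sup>2 + g v * (\<Sum>i\<le>v. \<sigma> i * z i)\<^sup>2)"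
      if z: "\<And>v. 0 \<le> z v \<and> z v \<le> int n" for z :: "nat \<Rightarrow> int"
    proof -
      have "0 \<le> (\<Sum>v<T. \<Sum>u<T. E v u * real_of_int (z v) * real_of_int (z u))"
        by (rule quadratic_form_nonneg[where lev = lev and \<eta> = \<eta> and \<epsilon> = \<epsilon> and n = n])
          (use sym rows same cross \<epsilon>0 dom z in auto)
      then show ?thesis using quad[of "\<lambda>v. real_of_int (z v)"] by simp
    qed
    show "(\<Sum>v<T. \<beta> v * (y (lev v))\<^sup>2 + g v * (\<Sum>i\<le>v. \<sigma> i * y (lev i))\<^sup>2)
        = (\<Sum>v<T. w v * y (lev v))\<^sup>2" for y :: "nat \<Rightarrow> int"
      using quad[of "\<lambda>v. real_of_int (y (lev v))"]
        quadratic_form_consistent[where E = E and T = T and lev = lev and y = "\<lambda>t. real_of_int (y t)", OF sym rows]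
      by simp
  qed
qed

section \<open>Breakpoints of the best response\<close>

text \<open>\<open>c i\<close> is the first point where a steeper line catches the tangent of the
  parabola at \<open>p i\<close>. It need not be the crossing of neighbouring tangents, because
  other elements of \<open>\<M>\<close> may rise above both of them in between. Only its position
  and the slopes around it are recorded: preferring larger slopes at \<open>c i\<close> leads to a
  slope above \<open>p i\<close> and at most \<open>p (Suc i)\<close>, so different indices cannot
  share an optimum.\<close>

lemma envelope_breakpoints:
  fixes \<M> :: "'a set" and a b :: "'a \<Rightarrow> real" and p :: "nat \<Rightarrow> real" and m :: nat
  defines "u \<equiv> \<lambda>x M. 2 * x * a M - b M"
  assumes fin: "finite \<M>"
    and below: "\<And>M. M \<in> \<M> \<Longrightarrow> (a M)\<^sup>2 \<le> b M"
    and p: "\<And>i. Suc i < m \<Longrightarrow> p i < p (Suc i)"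
    and ex: "\<And>i. i < m \<Longrightarrow> \<exists>M\<in>\<M>. a M = p i \<and> b M = (p i)\<^sup>2"
  obtains c :: "nat \<Rightarrow> real" where
    "\<And>i. Suc i < m \<Longrightarrow> p i < c i \<and> c i < p (Suc i)"
    "\<And>i x M. Suc i < m \<Longrightarrow> x < c i \<Longrightarrow> M \<in> \<M> \<Longrightarrow> (\<And>M'. M' \<in> \<M> \<Longrightarrow> u x M' \<le> u x M) \<Longrightarrow> a M \<le> p i"
    "\<And>i M. Suc i < m \<Longrightarrow> M \<in> \<M> \<Longrightarrow> (\<And>M'. M' \<in> \<M> \<Longrightarrow> u (c i) M' \<le> u (c i) M) \<Longrightarrow> a M \<le> p (Suc i)"
    "\<And>i. Suc i < m \<Longrightarrow> \<exists>M\<in>\<M>. p i < a M \<and> (\<forall>M'\<in>\<M>. u (c i) M' \<le> u (c i) M)"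
proof -
  define cross where "cross i M = (b M - (p i)\<^sup>2) / (2 * (a M - p i))" for i M
  define S where "S i = {M \<in> \<M>. p i < a M}" for i
  define c where "c i = Min (cross i ` S i)" for i
  have finS: "finite (S i)" for i using fin by (simp add: S_def)
  have above: "u x M \<le> x\<^sup>2" if "M \<in> \<M>" for x M
  proof -
    have "0 \<le> (x - a M)\<^sup>2" by simp
    then show ?thesis using below[OF that] by (simp add: u_def power2_diff)
  qed
  have next_ex: "\<exists>M\<in>S i. a M = p (Suc i) \<and> b M = (p (Suc i))\<^sup>2" if "Suc i < m" for i
    using ex[OF that] p[OF that] by (auto simp: S_def)
  have low: "p i < cross i M" if "M \<in> S i" for i M
  proof -
    have pos: "0 < 2 * (a M - p i)" using that by (simp add: S_def)
    have "2 * (a M - p i) * p i < (a M)\<^sup>2 - (p i)\<^sup>2"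
    proof -
      have "0 < (a M - p i)\<^sup>2" using pos by simp
      then show ?thesis by (simp add: power2_eq_square algebra_simps)
    qed
    also have "\<dots> \<le> b M - (p i)\<^sup>2" using that below by (simp add: S_def)
    finally show ?thesis using pos by (simp add: cross_def pos_less_divide_eq mult.commute)
  qed
  have cmp: "u x M \<le> 2 * x * p i - (p i)\<^sup>2 \<longleftrightarrow> x \<le> cross i M" if "M \<in> S i" for i M x
  proof -
    have pos: "0 < 2 * (a M - p i)" using that by (simp add: S_def)
    have "x \<le> cross i M \<longleftrightarrow> x * (2 * (a M - p i)) \<le> b M - (p i)\<^sup>2"
      unfolding cross_def using pos by (rule pos_le_divide_eq)
    then show ?thesis by (auto simp: u_def algebra_simps)
  qed
  have c_le: "c i \<le> cross i M" if "M \<in> S i" for i M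
    unfolding c_def using finS that by simp
  have c_in: "\<exists>M\<in>S i. c i = cross i M" if "Suc i < m" for i
  proof -
    have "S i \<noteq> {}" using next_ex[OF that] by blast
    then have "c i \<in> cross i ` S i" unfolding c_def using finS by (intro Min_in) auto
    then show ?thesis by blast
  qed
  have 1: "p i < c i \<and> c i < p (Suc i)" if i: "Suc i < m" for i
  proof
    show "p i < c i" using c_in[OF i] low by auto
    obtain M where M: "M \<in> S i" "a M = p (Suc i)" "b M = (p (Suc i))\<^sup>2" using next_ex[OF i] by blast
    have "0 < (p (Suc i) - p i)\<^sup>2" using p[OF i] by simp
    then have "cross i M < p (Suc i)"
      using p[OF i] M by (simp add: cross_def pos_divide_less_eq power2_eq_square algebra_simps)
    then show "c i < p (Suc i)" using c_le[OF M(1)] by simp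
  qed
  have touch: "\<exists>M\<in>\<M>. u x M = 2 * x * p i - (p i)\<^sup>2" if "i < m" for i x
    using ex[OF that] unfolding u_def by metis
  show ?thesis
  proof (rule that[of c])
    show "p i < c i \<and> c i < p (Suc i)" if "Suc i < m" for i by (rule 1[OF that])
  next
    fix i x M
    assume i: "Suc i < m" and l: "x < c i" and M: "M \<in> \<M>"
      and opt: "\<And>M'. M' \<in> \<M> \<Longrightarrow> u x M' \<le> u x M"
    show "a M \<le> p i"
    proof (rule ccontr)
      \<comment> \<open>A steeper line stays on or below the tangent up to its crossing. Optimality
        makes the two equal at \<open>x\<close>, so the steeper one would be strictly above at
        \<open>cross i M\<close>.\<close>
      assume "\<not> a M \<le> p i"
      then have S: "M \<in> S i" using M by (simp add: S_def)
      have "2 * x * p i - (p i)\<^sup>2 \<le> u x M" using touch[of i x] i opt by force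
      moreover have "x < cross i M" using l c_le[OF S] by simp
      ultimately have "u x M = 2 * x * p i - (p i)\<^sup>2" using cmp[OF S, of x] by linarith
      moreover have "u (cross i M) M \<le> 2 * cross i M * p i - (p i)\<^sup>2" using cmp[OF S] by simp
      ultimately have "2 * ((cross i M - x) * (a M - p i)) \<le> 0" by (simp add: u_def algebra_simps)
      moreover have "0 < (cross i M - x) * (a M - p i)"
        using \<open>x < cross i M\<close> S by (intro mult_pos_pos) (auto simp: S_def)
      ultimately show False by linarith
    qed
  next
    fix i M
    assume i: "Suc i < m" and M: "M \<in> \<M>"
      and opt: "\<And>M'. M' \<in> \<M> \<Longrightarrow> u (c i) M' \<le> u (c i) M"
    show "a M \<le> p (Suc i)"
    proof (rule ccontr)
      \<comment> \<open>A line of larger slope that reaches the tangent at \<open>p (Suc i)\<close>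
        already at \<open>c i\<close>, left of the touching point, would exceed the parabola at
        \<open>p (Suc i)\<close>.\<close>
      assume g: "\<not> a M \<le> p (Suc i)"
      have "2 * c i * p (Suc i) - (p (Suc i))\<^sup>2 \<le> u (c i) M" using touch[of "Suc i" "c i"] i opt by force
      moreover have "u (p (Suc i)) M \<le> (p (Suc i))\<^sup>2" by (rule above[OF M])
      ultimately have "2 * ((p (Suc i) - c i) * (a M - p (Suc i))) \<le> 0"
        by (simp add: u_def algebra_simps power2_eq_square)
      moreover have "0 < (p (Suc i) - c i) * (a M - p (Suc i))"
        using g 1[OF i] by (intro mult_pos_pos) auto
      ultimately show False by linarith
    qed
  next
    fix i assume i: "Suc i < m"
    obtain M where M: "M \<in> S i" "c i = cross i M" using c_in[OF i] by blast
    have val: "u (c i) M = 2 * c i * p i - (p i)\<^sup>2"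
    proof -
      have "0 < 2 * (a M - p i)" using M by (simp add: S_def)
      then have "c i * (2 * (a M - p i)) = b M - (p i)\<^sup>2" unfolding M(2) cross_def by simp
      then show ?thesis by (simp add: u_def algebra_simps)
    qed
    have "u (c i) M' \<le> u (c i) M" if M': "M' \<in> \<M>" for M'
    proof (cases "M' \<in> S i")
      case True
      then show ?thesis using cmp c_le val by simp
    next
      case False
      then have a: "a M' \<le> p i" using M' by (simp add: S_def)
      have "u (p i) M' \<le> (p i)\<^sup>2" by (rule above[OF M'])
      moreover have "0 \<le> (c i - p i) * (p i - a M')" using a 1[OF i] by (intro mult_nonneg_nonneg) auto
      ultimately show ?thesis unfolding val by (simp add: u_def algebra_simps power2_eq_square)
    qed
    then show "\<exists>M\<in>\<M>. p i < a M \<and> (\<forall>M'\<in>\<M>. u (c i) M' \<le> u (c i) M)"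
      using M by (auto simp: S_def)
  qed
qed

section \<open>Perfect matchings and the passage to a valid instance\<close>

lemma matching_inj_on:
  assumes "matching M"
  shows "inj_on fst M" "inj_on snd M"
  using assms unfolding matching_def inj_on_def endpoints_def by fast+

lemma perfect_matching_images:
  assumes "bipartite_graph G" "perfect_matching G M"
  shows "fst ` M = left_verts G" "snd ` M = right_verts G"
proof -
  have E: "M \<subseteq> left_verts G \<times> right_verts G" and dis: "left_verts G \<inter> right_verts G = {}"
    using assms unfolding bipartite_graph_def perfect_matching_def by auto
  have ends: "fst e \<in> left_verts G \<and> snd e \<in> right_verts G" if "e \<in> M" for e
    using subsetD[OF E that] by (simp add: mem_Times_iff)
  have cover: "\<exists>e\<in>M. v = fst e \<or> v = snd e" if "v \<in> left_verts G \<union> right_verts G" for v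
    using assms(2) that unfolding perfect_matching_def verts_def endpoints_def by blast
  show "fst ` M = left_verts G"
  proof (intro equalityI subsetI)
    fix v assume v: "v \<in> left_verts G"
    then obtain e where "e \<in> M" "v = fst e \<or> v = snd e" using cover by blast
    then show "v \<in> fst ` M" using v ends dis by blast
  qed (use ends in auto)
  show "snd ` M = right_verts G"
  proof (intro equalityI subsetI)
    fix v assume v: "v \<in> right_verts G"
    then obtain e where "e \<in> M" "v = fst e \<or> v = snd e" using cover by blast
    then show "v \<in> snd ` M" using v ends dis by blast
  qed (use ends in auto)
qed

lemma card_imperfect_matching_less:
  assumes bip: "bipartite_graph G" and pm: "perfect_matching G N"
    and M: "M \<subseteq> edges G" "matching M" "\<not> perfect_matching G M"
  shows "card M < card N"
proof (rule ccontr)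
  assume "\<not> card M < card N"
  then have ge: "card N \<le> card M" by simp
  have fin: "finite (left_verts G)" "finite (right_verts G)" and E: "edges G \<subseteq> left_verts G \<times> right_verts G"
    using bip unfolding bipartite_graph_def by auto
  have N: "matching N" using pm unfolding perfect_matching_def by blast
  have "card (left_verts G) = card N" "card (right_verts G) = card N"
    using perfect_matching_images[OF bip pm] card_image matching_inj_on[OF N] by metis+
  moreover have "card (fst ` M) = card M" "card (snd ` M) = card M"
    using card_image matching_inj_on[OF M(2)] by blast+
  moreover have "fst ` M \<subseteq> left_verts G" "snd ` M \<subseteq> right_verts G" using E M(1) by force+
  ultimately have "fst ` M = left_verts G" "snd ` M = right_verts G"
    using fin ge by (metis card_seteq)+
  then have "perfect_matching G M"
    using M(1,2) unfolding perfect_matching_def verts_def endpoints_def by fastforce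
  with M(3) show False by simp
qed

definition many_breakpoints :: "'v reward_graph \<Rightarrow> nat \<Rightarrow> (nat \<Rightarrow> real) \<Rightarrow> real \<Rightarrow> bool" where
  "many_breakpoints G m \<alpha> Q \<longleftrightarrow>
     valid_instance G \<and> 2 \<le> m \<and> 0 < \<alpha> 2 \<and> \<alpha> 2 < Q \<and>
     (\<forall>x\<in>{\<alpha> 2..Q}. \<forall>e\<in>edges G. edge_weight G x e \<ge> 0) \<and>
     strict_mono_on {2..m} \<alpha> \<and> \<alpha> m < Q \<and>
     (\<forall>p. tie_breaking G p \<longrightarrow>
        (\<forall>i\<in>{2..m}.
           critical_value G p (\<alpha> i) \<and>
           max_weight_matching G (edge_weight G (\<alpha> i)) (demand G p (\<alpha> i)) \<and>
           perfect_matching G (demand G p (\<alpha> i))) \<and>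
        (\<forall>i\<in>{2..m}. \<forall>j\<in>{2..m}. i \<noteq> j \<longrightarrow> demand G p (\<alpha> i) \<noteq> demand G p (\<alpha> j)))"

text \<open>All perfect matchings have the same size, so a constant added to every edge reward
  changes no comparison among them, and a cost proportional to the new reward merely translates the
  contract. Breakpoints among perfect matchings thus survive the repairs that validity
  requires.\<close>

lemma normalised_instance:
  fixes H :: "'v reward_graph" and p :: "nat \<Rightarrow> real"
  assumes bip: "bipartite_graph H"
    and rew: "\<And>e. e \<in> edges H \<Longrightarrow> 0 \<le> edge_reward H e"
    and below: "\<And>M. perfect_matching H M \<Longrightarrow>
      (\<Sum>e\<in>M. edge_reward H e)\<^sup>2 \<le> (\<Sum>e\<in>M. edge_cost H e)"
    and m: "2 \<le> m" and p0: "0 \<le> p 0" and p: "\<And>i. Suc i < m \<Longrightarrow> p i < p (Suc i)"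
    and ex: "\<And>i. i < m \<Longrightarrow> \<exists>M. perfect_matching H M \<and>
      (\<Sum>e\<in>M. edge_reward H e) = p i \<and> (\<Sum>e\<in>M. edge_cost H e) = (p i)\<^sup>2"
  obtains G \<alpha> Q where "verts G = verts H" "many_breakpoints G m \<alpha> Q"
proof -
  define a where "a M = (\<Sum>e\<in>M. edge_reward H e)" for M
  define b where "b M = (\<Sum>e\<in>M. edge_cost H e)" for M
  define u where "u x M = 2 * x * a M - b M" for x M
  define \<M> where "\<M> = {M. perfect_matching H M}"
  have finE: "finite (edges H)"
    using bip unfolding bipartite_graph_def by (meson finite_SigmaI finite_subset)
  have \<M>E: "M \<subseteq> edges H" "matching M" if "M \<in> \<M>" for M
    using that by (auto simp: \<M>_def perfect_matching_def)
  have "\<M> \<subseteq> Pow (edges H)" using \<M>E by blast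
  then have fin\<M>: "finite \<M>" using finE by (meson finite_Pow_iff finite_subset)
  obtain c where c: "\<And>i. Suc i < m \<Longrightarrow> p i < c i \<and> c i < p (Suc i)"
    and left: "\<And>i x M. Suc i < m \<Longrightarrow> x < c i \<Longrightarrow> M \<in> \<M> \<Longrightarrow>
      (\<And>M'. M' \<in> \<M> \<Longrightarrow> u x M' \<le> u x M) \<Longrightarrow> a M \<le> p i"
    and upper: "\<And>i M. Suc i < m \<Longrightarrow> M \<in> \<M> \<Longrightarrow>
      (\<And>M'. M' \<in> \<M> \<Longrightarrow> u (c i) M' \<le> u (c i) M) \<Longrightarrow> a M \<le> p (Suc i)"
    and right: "\<And>i. Suc i < m \<Longrightarrow>
      \<exists>M\<in>\<M>. p i < a M \<and> (\<forall>M'\<in>\<M>. u (c i) M' \<le> u (c i) M)"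
    unfolding u_def
    by (rule envelope_breakpoints[OF fin\<M>, of a b m p])
      (use below p ex in \<open>auto simp: a_def b_def \<M>_def\<close>)
  have p_mono: "p i \<le> p j" if "i \<le> j" "j < m" for i j
    using that by (induction rule: dec_induct) (auto dest: p less_imp_le order_trans)
  have c_mono: "c i < c j" if "i < j" "Suc j < m" for i j
    using c[of i] c[of j] p_mono[of "Suc i" j] that by fastforce
  define Q0 where "Q0 = p (m - 1)"
  have c_Q0: "c i < Q0" if "Suc i < m" for i
  proof -
    have "p (Suc i) \<le> p (m - 1)" by (rule p_mono) (use that in auto)
    then show ?thesis using c[OF that] by (simp add: Q0_def)
  qed
  have c0: "0 < c 0" using c[of 0] p0 m by simp
  \<comment> \<open>The parameter is shifted by \<open>sB\<close> to make costs nonnegative, and every edge gets \<open>D\<close> in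
    addition so that for parameters at least \<open>l0\<close> larger matchings win; \<open>\<eta>\<close> and \<open>\<theta>\<close> scale contracts
    and rewards into the unit interval.\<close>
  define l0 where "l0 = c 0 / 2"
  have l0: "0 < l0" "l0 < c 0" using c0 by (auto simp: l0_def)
  have l0_c: "l0 < c i" if "Suc i < m" for i
    using c_mono[of 0 i] l0 that by (cases "i = 0") auto
  define sA where "sA = (\<Sum>e\<in>edges H. edge_reward H e)"
  define sB where "sB = (\<Sum>e\<in>edges H. \<bar>edge_cost H e\<bar>)"
  define D where "D = sA + sB / l0 + 1"
  have sA: "0 \<le> sA" unfolding sA_def by (intro sum_nonneg) (use rew in auto)
  have sB: "0 \<le> sB" unfolding sB_def by (intro sum_nonneg) auto
  have D1: "1 \<le> D" using sA sB l0 by (simp add: D_def)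
  have a_le: "a M \<le> sA" if "M \<subseteq> edges H" for M
    unfolding a_def sA_def by (rule sum_mono2) (use finE that rew in auto)
  have b_le: "\<bar>b M\<bar> \<le> sB" if "M \<subseteq> edges H" for M
  proof -
    have "\<bar>b M\<bar> \<le> (\<Sum>e\<in>M. \<bar>edge_cost H e\<bar>)" unfolding b_def by (rule sum_abs)
    also have "\<dots> \<le> sB" unfolding sB_def by (rule sum_mono2) (use finE that in auto)
    finally show ?thesis .
  qed
  have cost_le: "\<bar>edge_cost H e\<bar> \<le> sB" if "e \<in> edges H" for e
    using b_le[of "{e}"] that by (simp add: b_def)
  have a_nonneg: "0 \<le> a M" if "M \<subseteq> edges H" for M
    unfolding a_def by (intro sum_nonneg) (use that rew in auto)
  define \<eta> where "\<eta> = 1 / (\<bar>Q0\<bar> + sB + 1)"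
  define \<theta> where "\<theta> = 1 / (sA + card (edges H) * D + 1)"
  have \<eta>: "0 < \<eta>" using sB by (simp add: \<eta>_def)
  have \<theta>: "0 < \<theta>" using sA D1 by (simp add: \<theta>_def add_nonneg_pos)
  \<comment> \<open>The cost is halved because \<open>u\<close> uses \<open>2 * x\<close> where the
    edge weight has the parameter once.\<close>
  define G where "G = H\<lparr>edge_reward := \<lambda>e. \<theta> * (edge_reward H e + D),
    edge_cost := \<lambda>e. \<eta> * \<theta> * (sB * (edge_reward H e + D) + edge_cost H e / 2)\<rparr>"
  have G [simp]: "left_verts G = left_verts H" "right_verts G = right_verts H" "edges G = edges H"
    "edge_reward G = (\<lambda>e. \<theta> * (edge_reward H e + D))"
    "edge_cost G = (\<lambda>e. \<eta> * \<theta> * (sB * (edge_reward H e + D) + edge_cost H e / 2))"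
    by (simp_all add: G_def)
  have vG: "verts G = verts H" by (simp add: verts_def)
  have pmG: "perfect_matching G M = perfect_matching H M" for M
    by (simp add: perfect_matching_def verts_def)
  have bipG: "bipartite_graph G" using bip by (simp add: bipartite_graph_def)
  have rewG: "0 \<le> edge_reward G e" if "e \<in> edges H" for e using rew[OF that] \<theta> D1 by simp
  have costG: "0 \<le> edge_cost G e" if "e \<in> edges H" for e
  proof -
    have "sB * 1 \<le> sB * (edge_reward H e + D)"
      using rew[OF that] D1 sB by (intro mult_left_mono) auto
    then have "0 \<le> sB * (edge_reward H e + D) + edge_cost H e / 2"
      using cost_le[OF that] by linarith
    then show ?thesis using \<eta> \<theta> by simp
  qed
  have sum_rewG: "(\<Sum>e\<in>M. edge_reward G e) = \<theta> * (a M + D * card M)" for M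
    by (simp add: a_def sum_distrib_left[symmetric] sum.distrib mult.commute)
  have valid: "valid_instance G"
    unfolding valid_instance_def normalized_reward_def nonneg_edge_data_def
  proof (intro conjI ballI allI impI)
    fix S assume S: "S \<subseteq> edges G"
    then obtain M where M: "M \<subseteq> S" "reward G S = (\<Sum>e\<in>M. edge_reward G e)"
      using reward_attained[of S G] finE finite_subset G(3) by metis
    have ME: "M \<subseteq> edges H" using M S by auto
    have "a M + D * card M \<le> sA + card (edges H) * D + 1"
    proof -
      have "D * card M \<le> card (edges H) * D"
        using D1 card_mono[OF finE ME] by (subst mult.commute) (intro mult_right_mono, auto)
      then show ?thesis using a_le[OF ME] by linarith
    qed
    then have "reward G S \<le> \<theta> * (sA + card (edges H) * D + 1)"
      unfolding M(2) sum_rewG using \<theta> by (intro mult_left_mono) auto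
    also have "\<dots> = 1"
    proof -
      have "0 < sA + card (edges H) * D + 1" using sA D1 by (intro add_nonneg_pos add_nonneg_nonneg) auto
      then show ?thesis by (simp add: \<theta>_def)
    qed
    finally have "reward G S \<le> 1" .
    moreover have "0 \<le> reward G S"
      unfolding M(2) sum_rewG using a_nonneg[OF ME] \<theta> D1 by simp
    ultimately show "reward G S \<in> {0..1}" by simp
  qed (use bipG rewG costG in auto)
  define X where "X x = \<eta> * (x + sB)" for x
  have X_less [simp]: "X x < X y \<longleftrightarrow> x < y" for x y using \<eta> by (simp add: X_def)
  have X_le [simp]: "X x \<le> X y \<longleftrightarrow> x \<le> y" for x y using \<eta> by (simp add: X_def)
  have X_pos: "0 < X x" if "l0 \<le> x" for x using that l0 sB \<eta> by (simp add: X_def)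
  have X_1: "X x \<le> 1" if "x \<le> Q0" for x
    using that sB by (simp add: X_def \<eta>_def divide_le_eq_1 abs_if split: if_splits)
  have weight: "edge_weight G (X x) e = \<eta> * \<theta> * (x * (edge_reward H e + D) - edge_cost H e / 2)" for x e
    by (simp add: edge_weight_def X_def algebra_simps)
  have sum_weight: "(\<Sum>e\<in>M. edge_weight G (X x) e) = \<eta> * \<theta> / 2 * (u x M + 2 * x * D * card M)" for x M
  proof -
    have "(\<Sum>e\<in>M. edge_weight G (X x) e)
        = \<eta> * \<theta> * (\<Sum>e\<in>M. x * edge_reward H e + x * D - edge_cost H e / 2)"
      by (simp add: weight sum_distrib_left distrib_left)
    also have "(\<Sum>e\<in>M. x * edge_reward H e + x * D - edge_cost H e / 2)
        = x * a M + card M * (x * D) - b M / 2"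
      by (simp add: sum_subtractf sum.distrib a_def b_def sum_distrib_left sum_divide_distrib)
    finally show ?thesis by (simp add: u_def field_simps)
  qed
  \<comment> \<open>Slopes and intercepts can favour \<open>M\<close> by at most
    \<open>2 * x * sA + 2 * sB\<close>, while an additional edge brings \<open>2 * x * D\<close>.
    For \<open>x \<ge> l0\<close> the summand \<open>sB / l0\<close> of \<open>D\<close> is worth at
    least \<open>sB\<close> after multiplication by \<open>x\<close>.\<close>
  have dominate: "u x M + 2 * x * D * card M < u x N + 2 * x * D * card N"
    if x: "l0 \<le> x" and N: "N \<in> \<M>" and M: "M \<subseteq> edges H" "card M < card N" for x M N
  proof -
    have x0: "0 < x" using l0 x by simp
    have "2 * x * a M \<le> 2 * x * sA" using a_le[OF M(1)] x0 by simp
    moreover have "0 \<le> 2 * x * a N" using a_nonneg[OF \<M>E(1)[OF N]] x0 by simp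
    moreover have "\<bar>b M\<bar> \<le> sB" "\<bar>b N\<bar> \<le> sB" using b_le M(1) \<M>E(1)[OF N] by auto
    ultimately have "u x M - u x N \<le> 2 * x * sA + 2 * sB" unfolding u_def by linarith
    also have "\<dots> < 2 * x * D"
    proof -
      have "sB = l0 * (sB / l0)" using l0 by simp
      also have "\<dots> \<le> x * (sB / l0)" using x sB l0 by (intro mult_right_mono) auto
      finally have "sB < x * (sB / l0) + x" using x0 by simp
      moreover have "2 * x * D = 2 * x * sA + 2 * (x * (sB / l0)) + 2 * x"
        by (simp only: D_def distrib_left mult.assoc mult_1_right)
      ultimately show ?thesis by linarith
    qed
    also have "\<dots> \<le> 2 * x * D * (real (card N) - real (card M))"
    proof -
      have "1 \<le> real (card N) - real (card M)" using M(2) by linarith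
      then show ?thesis using x0 D1 mult_left_mono[of 1 _ "2 * x * D"] by simp
    qed
    finally show ?thesis by (simp add: algebra_simps)
  qed
  obtain M0 where M0: "M0 \<in> \<M>" using ex[of 0] m unfolding \<M>_def by auto
  have card_\<M>: "card M = card N" if "M \<in> \<M>" "N \<in> \<M>" for M N
  proof -
    have "card K = card (left_verts H)" if "K \<in> \<M>" for K
      using perfect_matching_images(1)[OF bip, of K] card_image[of fst K] \<M>E[OF that]
        matching_inj_on(1)[of K] that by (simp add: \<M>_def)
    then show ?thesis using that by simp
  qed
  have max_perfect: "M \<in> \<M> \<and> (\<forall>M'\<in>\<M>. u x M' \<le> u x M)"
    if x: "l0 \<le> x" and mwm: "max_weight_matching G (edge_weight G (X x)) M" for x M
  proof -
    have M: "M \<subseteq> edges H" "matching M" using mwm by (auto simp: max_weight_matching_def is_arg_max_def)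
    have opt: "u x N + 2 * x * D * card N \<le> u x M + 2 * x * D * card M" if "N \<in> \<M>" for N
    proof -
      have "(\<Sum>e\<in>N. edge_weight G (X x) e) \<le> (\<Sum>e\<in>M. edge_weight G (X x) e)"
        using mwm \<M>E[OF that] by (auto simp: max_weight_matching_def is_arg_max_def not_less)
      then show ?thesis unfolding sum_weight using \<eta> \<theta> by simp
    qed
    have "M \<in> \<M>"
    proof (rule ccontr)
      assume "M \<notin> \<M>"
      then have "card M < card M0"
        using card_imperfect_matching_less[OF bip _ M, of M0] M0 by (simp add: \<M>_def)
      then show False using dominate[OF x M0 M(1)] opt[OF M0] by simp
    qed
    moreover have "u x N \<le> u x M" if "N \<in> \<M>" for N
      using opt[OF that] card_\<M>[OF that \<open>M \<in> \<M>\<close>] by simp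
    ultimately show ?thesis by blast
  qed
  \<comment> \<open>The \<open>m\<close> touching points have \<open>m - 1\<close> gaps, with
    breakpoints \<open>c 0\<close> to \<open>c (m - 2)\<close>; these become the indices 2 to
    \<open>m\<close>.\<close>
  define \<alpha> where "\<alpha> i = X (c (i - 2))" for i :: nat
  have idx: "Suc (i - 2) < m" if "i \<in> {2..m}" for i using that m by auto
  have many: "many_breakpoints G m \<alpha> (X Q0)"
    unfolding many_breakpoints_def
  proof (intro conjI ballI allI impI)
    show "valid_instance G" by (rule valid)
    show "2 \<le> m" by (rule m)
    show "0 < \<alpha> 2" using X_pos l0 by (simp add: \<alpha>_def)
    show "\<alpha> 2 < X Q0" "\<alpha> m < X Q0" using c_Q0 idx[of 2] idx[of m] m by (auto simp: \<alpha>_def)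
    show "strict_mono_on {2..m} \<alpha>"
    proof (rule strict_mono_onI)
      fix i j assume "i \<in> {2..m}" "j \<in> {2..m}" "i < j"
      then show "\<alpha> i < \<alpha> j" using c_mono[of "i - 2" "j - 2"] idx[of j] by (simp add: \<alpha>_def)
    qed
    show "0 \<le> edge_weight G x e" if x: "x \<in> {\<alpha> 2..X Q0}" and e: "e \<in> edges G" for x e
    proof -
      define y where "y = x / \<eta> - sB"
      have xy: "x = X y" using \<eta> by (simp add: X_def y_def)
      then have "c 0 \<le> y" using x by (simp add: \<alpha>_def)
      then have y: "l0 \<le> y" "0 \<le> y" using l0 by auto
      have "edge_cost H e \<le> sB" using cost_le[of e] e by simp
      also have "sB = l0 * (sB / l0)" using l0 by simp
      also have "\<dots> \<le> y * (sB / l0)" using y sB l0 by (intro mult_right_mono) auto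
      also have "\<dots> \<le> y * (edge_reward H e + D)"
        using y sA rew[of e] e by (intro mult_left_mono) (auto simp: D_def)
      finally have "edge_cost H e \<le> y * (edge_reward H e + D)" .
      moreover have "0 \<le> y * (edge_reward H e + D)" using y rew[of e] e D1 by simp
      ultimately have "0 \<le> y * (edge_reward H e + D) - edge_cost H e / 2" by linarith
      then show ?thesis unfolding xy weight using \<eta> \<theta> by simp
    qed
  next
    fix q assume tb: "tie_breaking G q"
    let ?d = "\<lambda>i. demand G q (\<alpha> i)"
    have dem: "demand G q (X x) \<in> favored_responses G (X x)"
        "max_weight_matching G (edge_weight G (X x)) (demand G q (X x))" if "l0 \<le> x" for x
      using demand_max_weight_matching[OF valid tb, of "X x"] X_pos[OF that] by auto
    have perf: "demand G q (X x) \<in> \<M> \<and> (\<forall>M'\<in>\<M>. u x M' \<le> u x (demand G q (X x)))"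
      if "l0 \<le> x" for x by (rule max_perfect[OF that dem(2)[OF that]])
    have l0i: "l0 \<le> c (i - 2)" if "i \<in> {2..m}" for i using l0_c[OF idx[OF that]] by simp
    have perf_i: "?d i \<in> \<M>" if "i \<in> {2..m}" for i
      using perf[OF l0i[OF that]] by (simp add: \<alpha>_def)
    have slope_le: "a (?d i) \<le> p (Suc (i - 2))" if "i \<in> {2..m}" for i
      using upper[OF idx[OF that]] perf[OF l0i[OF that]] by (simp add: \<alpha>_def)
    \<comment> \<open>Among perfect matchings the reward is increasing in the slope
      \<open>a\<close>. Hence ties broken in favour of larger reward select a slope at least that of
      the steeper optimum \<open>N\<close> available at the breakpoint.\<close>
    have slope_gr: "p (i - 2) < a (?d i)" if i: "i \<in> {2..m}" for i
    proof -
      let ?x = "c (i - 2)" and ?S = "?d i"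
      obtain N where N: "N \<in> \<M>" "p (i - 2) < a N" "\<forall>M'\<in>\<M>. u ?x M' \<le> u ?x N"
        using right[OF idx[OF i]] by blast
      have S: "?S \<in> \<M>" by (rule perf_i[OF i])
      have rew_\<M>: "reward G M = \<theta> * (a M + D * card M0)" if "M \<in> \<M>" for M
      proof -
        have "reward G M = (\<Sum>e\<in>M. edge_reward G e)"
          using \<M>E[OF that] finE rewG by (intro reward_matching) (auto intro: finite_subset)
        then show ?thesis using card_\<M>[OF that M0] by (simp only: sum_rewG)
      qed
      have util: "agent_utility G (X ?x) M = \<eta> * \<theta> / 2 * (u ?x M + 2 * ?x * D * card M0)"
        if "M \<in> \<M>" for M
      proof -
        have "reward G M = (\<Sum>e\<in>M. edge_reward G e)"
          using \<M>E[OF that] finE rewG by (intro reward_matching) (auto intro: finite_subset)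
        then have "agent_utility G (X ?x) M = (\<Sum>e\<in>M. edge_weight G (X ?x) e)"
          unfolding agent_utility_def cost_def edge_weight_def
          by (simp only: sum_subtractf sum_distrib_left)
        then show ?thesis using card_\<M>[OF that M0] by (simp only: sum_weight)
      qed
      have fav: "?S \<in> favored_responses G (X ?x)" using dem(1)[OF l0i[OF i]] by (simp only: \<alpha>_def)
      then have "?S \<in> best_responses G (X ?x)" by (auto simp: favored_responses_def is_arg_max_def)
      moreover have "agent_utility G (X ?x) ?S \<le> agent_utility G (X ?x) N"
        unfolding util[OF S] util[OF N(1)] using N(3) S \<eta> \<theta> by simp
      ultimately have "N \<in> best_responses G (X ?x)"
        using \<M>E(1)[OF N(1)]
        by (auto simp: best_responses_def is_arg_max_def not_less intro: order_trans)
      then have "reward G N \<le> reward G ?S"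
        using fav by (auto simp: favored_responses_def is_arg_max_def not_less)
      then have "a N \<le> a ?S" unfolding rew_\<M>[OF S] rew_\<M>[OF N(1)] using \<theta> by simp
      with N(2) show ?thesis by simp
    qed
    show "max_weight_matching G (edge_weight G (\<alpha> i)) (?d i)" if "i \<in> {2..m}" for i
      using dem(2)[OF l0i[OF that]] by (simp only: \<alpha>_def)
    show "perfect_matching G (?d i)" if "i \<in> {2..m}" for i
      using perf_i[OF that] by (simp add: \<M>_def pmG)
    have less: "?d i \<noteq> ?d j" if "i \<in> {2..m}" "j \<in> {2..m}" "i < j" for i j
      using slope_le[OF that(1)] slope_gr[OF that(2)] p_mono[of "Suc (i - 2)" "j - 2"] idx[OF that(2)] that
      by fastforce
    show "?d i \<noteq> ?d j" if "i \<in> {2..m}" "j \<in> {2..m}" "i \<noteq> j" for i j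
      using less[of i j] less[of j i] that by (cases i j rule: linorder_cases) auto
    show "critical_value G q (\<alpha> i)" if i: "i \<in> {2..m}" for i
      unfolding critical_value_def
    proof (intro disjI2 conjI allI impI)
      let ?c = "c (i - 2)"
      show "\<alpha> i \<in> {0<..1}"
        using X_pos[OF l0i[OF i]] X_1[of ?c] c_Q0[OF idx[OF i]] by (simp add: \<alpha>_def)
      fix \<epsilon> :: real assume \<epsilon>: "0 < \<epsilon>"
      \<comment> \<open>Because \<open>l0\<close> lies strictly below every breakpoint, there is
        room on the left even of the first one where the demand is still perfect. Dividing by
        \<open>\<eta>\<close> undoes the scaling of contracts, and the factor 2 makes the distance
        strictly less than \<open>\<epsilon>\<close>.\<close>
      define x where "x = max l0 (?c - \<epsilon> / (2 * \<eta>))"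
      have x: "l0 \<le> x" "x < ?c" using l0_c[OF idx[OF i]] \<epsilon> \<eta> by (auto simp: x_def)
      have "?c - x \<le> \<epsilon> / (2 * \<eta>)" by (simp add: x_def)
      then have "\<eta> * (?c - x) \<le> \<eta> * (\<epsilon> / (2 * \<eta>))" using \<eta> by (intro mult_left_mono) auto
      also have "\<dots> < \<epsilon>" using \<epsilon> \<eta> by simp
      finally have "\<alpha> i - \<epsilon> < X x" by (simp add: \<alpha>_def X_def algebra_simps)
      moreover have "X x < \<alpha> i" using x by (simp add: \<alpha>_def)
      moreover have "X x \<in> {0..1}"
        using X_pos[OF x(1)] X_1[of x] x c_Q0[OF idx[OF i]] by simp
      moreover have "demand G q (X x) \<noteq> ?d i"
        using left[OF idx[OF i] x(2)] perf[OF x(1)] slope_gr[OF i] by force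
      ultimately show "\<exists>x\<in>{0..1}. \<alpha> i - \<epsilon> < x \<and> x < \<alpha> i \<and> demand G q x \<noteq> ?d i" by blast
    qed
  qed
  show ?thesis by (rule that[OF vG many])
qed

section \<open>The layered network\<close>

text \<open>The flag tells the two copies of a network node apart; numbering gives all instances the
  same vertex type.\<close>

definition encode :: "bool \<Rightarrow> nat \<times> int \<Rightarrow> nat" where
  "encode b u = to_nat (b, u)"

definition decode :: "nat \<Rightarrow> nat \<times> int" where
  "decode k = snd (from_nat k :: bool \<times> nat \<times> int)"

lemma decode_encode [simp]: "decode (encode b u) = u"
  by (simp add: encode_def decode_def)

lemma encode_eq_iff [simp]: "encode b u = encode b' u' \<longleftrightarrow> b = b' \<and> u = u'"
  by (simp add: encode_def)

lemma inj_on_encode: "inj_on (encode b) A"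
  by (simp add: inj_on_def)

text \<open>Paths become perfect matchings by node splitting: an outgoing copy on the left, an
  incoming copy on the right, and a free edge between the two copies for nodes off the path. The
  source lacks the incoming copy and the sink the outgoing one. Registers have absolute value at
  most \<open>T * n\<close>, whence the number of vertices.\<close>

lemma layered_instance:
  fixes T n :: nat and \<sigma> :: "nat \<Rightarrow> int" and w \<beta> g :: "nat \<Rightarrow> real"
  assumes T: "0 < T" and \<sigma>: "\<And>v. v < T \<Longrightarrow> \<bar>\<sigma> v\<bar> = 1" and w: "\<And>v. 0 \<le> w v"
    and below: "\<And>z :: nat \<Rightarrow> int. (\<And>v. 0 \<le> z v \<and> z v \<le> int n) \<Longrightarrow>
      (\<Sum>v<T. w v * z v)\<^sup>2 \<le> (\<Sum>v<T. \<beta> v * (z v)\<^sup>2 + g v * (\<Sum>i\<le>v. \<sigma> i * z i)\<^sup>2)"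
  obtains H :: "nat reward_graph" where
    "bipartite_graph H" "\<And>e. e \<in> edges H \<Longrightarrow> 0 \<le> edge_reward H e"
    "card (verts H) \<le> 2 * ((T + 1) * (2 * T * n + 1))"
    "\<And>M. perfect_matching H M \<Longrightarrow> (\<Sum>e\<in>M. edge_reward H e)\<^sup>2 \<le> (\<Sum>e\<in>M. edge_cost H e)"
    "\<And>z :: nat \<Rightarrow> int. (\<And>v. 0 \<le> z v \<and> z v \<le> int n) \<Longrightarrow> (\<Sum>v<T. \<sigma> v * z v) = 0 \<Longrightarrow>
      \<exists>M. perfect_matching H M \<and> (\<Sum>e\<in>M. edge_reward H e) = (\<Sum>v<T. w v * z v) \<and>
        (\<Sum>e\<in>M. edge_cost H e) = (\<Sum>v<T. \<beta> v * (z v)\<^sup>2 + g v * (\<Sum>i\<le>v. \<sigma> i * z i)\<^sup>2)"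
proof -
  define reg where "reg t z = (\<Sum>i<t. \<sigma> i * z i)" for t and z :: "nat \<Rightarrow> int"
  define Z where "Z = {z :: nat \<Rightarrow> int. \<forall>v. (v \<in> {..<T} \<longrightarrow> z v \<in> {0..int n}) \<and> (v \<notin> {..<T} \<longrightarrow> z v = 0)}"
  \<comment> \<open>Only reachable registers become nodes, so the minimum defining the potential
    \<open>\<phi>\<close> of a node ranges over a nonempty set. In the last layer only the register
    0 is kept, which is the sink.\<close>
  define N where "N = {(t, reg t z) | t z. t \<le> T \<and> z \<in> Z \<and> (t = T \<longrightarrow> reg t z = 0)}"
  define src where "src = (0::nat, 0::int)"
  define snk where "snk = (T, 0::int)"
  \<comment> \<open>A sign is its own inverse, so this recovers the digit from the change of the
    register.\<close>
  define dig where "dig u v = \<sigma> (fst u) * (snd v - snd u)" for u v :: "nat \<times> int"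
  define arc where "arc u v \<longleftrightarrow> fst u < T \<and> fst v = Suc (fst u) \<and> dig u v \<in> {0..int n}" for u v
  define rw where "rw u v = (if fst v = fst u then 0 else w (fst u) * dig u v)" for u v
  define co where "co u v = (if fst v = fst u then 0
    else \<beta> (fst u) * (dig u v)\<^sup>2 + g (fst u) * (snd v)\<^sup>2)" for u v
  define H where "H = \<lparr>left_verts = encode False ` (N - {snk}), right_verts = encode True ` (N - {src}),
    edges = {(encode False u, encode True v) | u v. u \<in> N - {snk} \<and> v \<in> N - {src} \<and> (arc u v \<or> u = v)},
    edge_reward = (\<lambda>e. rw (decode (fst e)) (decode (snd e))),
    edge_cost = (\<lambda>e. co (decode (fst e)) (decode (snd e)))\<rparr>"
  have H [simp]: "left_verts H = encode False ` (N - {snk})" "right_verts H = encode True ` (N - {src})"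
    "edge_reward H = (\<lambda>e. rw (decode (fst e)) (decode (snd e)))"
    "edge_cost H = (\<lambda>e. co (decode (fst e)) (decode (snd e)))"
    by (simp_all add: H_def)
  have EH: "edges H = {(encode False u, encode True v) | u v.
      u \<in> N - {snk} \<and> v \<in> N - {src} \<and> (arc u v \<or> u = v)}" by (simp add: H_def)
  have \<sigma>\<sigma>: "\<sigma> v * (\<sigma> v * d) = d" if "v < T" for v d
    using \<sigma>[OF that] by (auto simp: abs_if split: if_splits)
  have finZ: "finite Z" unfolding Z_def by (rule finite_set_of_finite_funs) auto
  have Z_range: "0 \<le> z v \<and> z v \<le> int n" if "z \<in> Z" for z v
    using that unfolding Z_def by (cases "v < T") auto
  have Z0: "(\<lambda>_. 0) \<in> Z" by (simp add: Z_def)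
  have reg_bound: "\<bar>reg t z\<bar> \<le> int (T * n)" if z: "z \<in> Z" and t: "t \<le> T" for t z
  proof -
    have "\<bar>reg t z\<bar> \<le> (\<Sum>i<t. \<bar>\<sigma> i * z i\<bar>)" unfolding reg_def by (rule sum_abs)
    also have "\<dots> \<le> (\<Sum>i<t. int n)"
      by (rule sum_mono) (use \<sigma> Z_range[OF z] t in \<open>auto simp: abs_mult\<close>)
    also have "\<dots> \<le> int (T * n)" using t by (simp add: mult_right_mono flip: of_nat_mult)
    finally show ?thesis .
  qed
  have N_sub: "N \<subseteq> {..T} \<times> {- int (T * n)..int (T * n)}"
  proof
    fix u assume "u \<in> N"
    then obtain t z where u: "u = (t, reg t z)" "t \<le> T" "z \<in> Z" unfolding N_def by blast
    then show "u \<in> {..T} \<times> {- int (T * n)..int (T * n)}" using reg_bound[OF u(3,2)] by auto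
  qed
  then have finN: "finite N" by (rule finite_subset) auto
  have src: "src \<in> N" and snk: "snk \<in> N"
    using Z0 T unfolding N_def src_def snk_def by (force simp: reg_def)+
  have bip: "bipartite_graph H"
    unfolding bipartite_graph_def using finN by (auto simp: EH)
  have card_verts: "card (verts H) \<le> 2 * ((T + 1) * (2 * T * n + 1))"
  proof -
    have "card N \<le> card ({..T} \<times> {- int (T * n)..int (T * n)})"
      by (rule card_mono[OF _ N_sub]) auto
    also have "\<dots> = (T + 1) * (2 * T * n + 1)"
      by (simp add: card_cartesian_product) (simp add: nat_add_distrib nat_mult_distrib)
    finally have N: "card N \<le> (T + 1) * (2 * T * n + 1)" .
    have "card (verts H) \<le> card (encode False ` (N - {snk})) + card (encode True ` (N - {src}))"
      unfolding verts_def H by (rule card_Un_le)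
    also have "\<dots> \<le> card N + card N"
      using finN by (intro add_mono order_trans[OF card_image_le] card_mono) auto
    finally show ?thesis using N by linarith
  qed
  have rew: "0 \<le> edge_reward H e" if "e \<in> edges H" for e
    using that w by (auto simp: EH rw_def arc_def)
  define pc where "pc x t z = (\<Sum>v<t. \<beta> v * (z v)\<^sup>2 + g v * (reg (Suc v) z)\<^sup>2 - 2 * x * (w v * z v))"
    for x :: real and t and z :: "nat \<Rightarrow> int"
  \<comment> \<open>The distances from the source are a dual solution, so they bound all perfect matchings
    without extracting a path from a matching.\<close>
  define \<phi> where "\<phi> x u = Min (pc x (fst u) ` {z \<in> Z. reg (fst u) z = snd u})" for x u
  have \<phi>_le: "\<phi> x u \<le> pc x (fst u) z" if "z \<in> Z" "reg (fst u) z = snd u" for x u z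
    unfolding \<phi>_def using that finZ by (intro Min_le) auto
  have \<phi>_attained: "\<exists>z\<in>Z. reg (fst u) z = snd u \<and> \<phi> x u = pc x (fst u) z" if "u \<in> N" for x u
  proof -
    have "{z \<in> Z. reg (fst u) z = snd u} \<noteq> {}" using that unfolding N_def by auto
    then have "\<phi> x u \<in> pc x (fst u) ` {z \<in> Z. reg (fst u) z = snd u}"
      unfolding \<phi>_def using finZ by (intro Min_in) auto
    then show ?thesis by auto
  qed
  have \<phi>_edge: "\<phi> x v - \<phi> x u \<le> co u v - 2 * x * rw u v"
    if u: "u \<in> N" and e: "arc u v \<or> u = v" for x u v
    using e
  proof
    assume a: "arc u v"
    obtain z where z: "z \<in> Z" "reg (fst u) z = snd u" "\<phi> x u = pc x (fst u) z"
      using \<phi>_attained[OF u] by blast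
    define t where "t = fst u"
    define z' where "z' = z(t := dig u v)"
    have t: "t < T" "fst v = Suc t" using a by (auto simp: arc_def t_def)
    have z'Z: "z' \<in> Z" using z(1) a t by (auto simp: Z_def z'_def arc_def)
    have reg_eq: "reg k z' = reg k z" if "k \<le> t" for k
      unfolding reg_def z'_def using that by (intro sum.cong) auto
    have "\<sigma> t * z' t = snd v - snd u" using \<sigma>\<sigma>[OF t(1)] by (simp only: z'_def dig_def t_def fun_upd_same)
    then have reg': "reg (Suc t) z' = snd v"
      using reg_eq[of t] z(2) by (simp add: reg_def t_def)
    have "pc x t z' = pc x t z"
      unfolding pc_def by (intro sum.cong) (use reg_eq in \<open>auto simp: z'_def\<close>)
    then have "pc x (Suc t) z' = \<phi> x u + (\<beta> t * (dig u v)\<^sup>2 + g t * (snd v)\<^sup>2 - 2 * x * (w t * dig u v))"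
      using z(3) reg' unfolding pc_def t_def[symmetric] by (simp add: z'_def)
    moreover have "\<phi> x v \<le> pc x (Suc t) z'" using \<phi>_le[OF z'Z, of v x] reg' t by simp
    ultimately show ?thesis using t by (simp add: co_def rw_def t_def)
  qed (simp add: co_def rw_def)
  have \<phi>_src: "\<phi> x src = 0" for x
    using \<phi>_attained[OF src, of x] by (auto simp: src_def pc_def)
  have \<phi>_snk: "- x\<^sup>2 \<le> \<phi> x snk" for x
  proof -
    obtain z where z: "z \<in> Z" "\<phi> x snk = pc x T z" using \<phi>_attained[OF snk, of x] by (auto simp: snk_def)
    define A where "A = (\<Sum>v<T. w v * z v)"
    have "pc x T z = (\<Sum>v<T. \<beta> v * (z v)\<^sup>2 + g v * (\<Sum>i\<le>v. \<sigma> i * z i)\<^sup>2) - 2 * x * A"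
      unfolding pc_def reg_def A_def
      by (simp only: sum_subtractf sum_distrib_left lessThan_Suc_atMost)
    also have "\<dots> \<ge> A\<^sup>2 - 2 * x * A" using below[of z] Z_range[OF z(1)] by (simp add: A_def)
    finally have "A\<^sup>2 - 2 * x * A \<le> \<phi> x snk" using z(2) by simp
    moreover have "0 \<le> (x - A)\<^sup>2" by simp
    ultimately show ?thesis by (simp add: power2_diff)
  qed
  have pm_below: "(\<Sum>e\<in>M. edge_reward H e)\<^sup>2 \<le> (\<Sum>e\<in>M. edge_cost H e)" if pm: "perfect_matching H M" for M
  proof -
    \<comment> \<open>The parameter is the slope of \<open>M\<close> itself. The weights then add up
      to the cost minus \<open>2 * x * x\<close>, the potentials cancel except at source and sink,
      and the bound \<open>- x\<^sup>2\<close> at the sink is precisely the claim.\<close>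
    define x where "x = (\<Sum>e\<in>M. edge_reward H e)"
    let ?f = "\<phi> x"
    have ME: "M \<subseteq> edges H" "matching M" using pm by (auto simp: perfect_matching_def)
    have "(\<Sum>e\<in>M. ?f (decode (snd e)) - ?f (decode (fst e))) \<le> (\<Sum>e\<in>M. edge_cost H e - 2 * x * edge_reward H e)"
    proof (rule sum_mono)
      fix e assume "e \<in> M"
      then obtain u v where "e = (encode False u, encode True v)" "u \<in> N" "arc u v \<or> u = v"
        using ME(1) unfolding EH by blast
      then show "?f (decode (snd e)) - ?f (decode (fst e)) \<le> edge_cost H e - 2 * x * edge_reward H e"
        using \<phi>_edge[of u v x] by simp
    qed
    also have "\<dots> = (\<Sum>e\<in>M. edge_cost H e) - 2 * x * x"
      unfolding x_def by (simp only: sum_subtractf sum_distrib_left)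
    finally have "(\<Sum>e\<in>M. ?f (decode (snd e))) - (\<Sum>e\<in>M. ?f (decode (fst e))) \<le> (\<Sum>e\<in>M. edge_cost H e) - 2 * x * x"
      by (simp only: sum_subtractf)
    moreover have "(\<Sum>e\<in>M. ?f (decode (snd e))) = (\<Sum>k\<in>snd ` M. ?f (decode k))"
      by (simp add: sum.reindex matching_inj_on[OF ME(2)])
    moreover have "(\<Sum>e\<in>M. ?f (decode (fst e))) = (\<Sum>k\<in>fst ` M. ?f (decode k))"
      by (simp add: sum.reindex matching_inj_on[OF ME(2)])
    moreover have "(\<Sum>k\<in>snd ` M. ?f (decode k)) = (\<Sum>u\<in>N. ?f u) - ?f src"
      unfolding perfect_matching_images[OF bip pm] H
      by (simp add: sum.reindex inj_on_encode sum_diff1 finN src)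
    moreover have "(\<Sum>k\<in>fst ` M. ?f (decode k)) = (\<Sum>u\<in>N. ?f u) - ?f snk"
      unfolding perfect_matching_images[OF bip pm] H
      by (simp add: sum.reindex inj_on_encode sum_diff1 finN snk)
    ultimately have "?f snk - ?f src \<le> (\<Sum>e\<in>M. edge_cost H e) - 2 * x * x" by linarith
    then have "x\<^sup>2 \<le> (\<Sum>e\<in>M. edge_cost H e)"
      using \<phi>_src[of x] \<phi>_snk[of x] by (simp add: power2_eq_square)
    then show ?thesis by (simp only: x_def)
  qed
  have path: "\<exists>M. perfect_matching H M \<and> (\<Sum>e\<in>M. edge_reward H e) = (\<Sum>v<T. w v * z v) \<and>
        (\<Sum>e\<in>M. edge_cost H e) = (\<Sum>v<T. \<beta> v * (z v)\<^sup>2 + g v * (\<Sum>i\<le>v. \<sigma> i * z i)\<^sup>2)"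
    if z: "\<And>v. 0 \<le> z v \<and> z v \<le> int n" and z0: "(\<Sum>v<T. \<sigma> v * z v) = 0" for z :: "nat \<Rightarrow> int"
  proof -
    define P where "P t = (t, reg t z)" for t
    \<comment> \<open>Path nodes move to their successor and all other nodes stay; the matching is
      the graph of this bijection from outgoing to incoming copies.\<close>
    define f where "f u = (if u = P (fst u) then P (Suc (fst u)) else u)" for u
    define M where "M = (\<lambda>u. (encode False u, encode True (f u))) ` (N - {snk})"
    have P_N: "P t \<in> N" if "t \<le> T" for t
    proof -
      define y where "y v = (if v < T then z v else 0)" for v
      have "y \<in> Z" using z by (simp add: Z_def y_def)
      moreover have "reg t y = reg t z" unfolding reg_def y_def using that by (intro sum.cong) auto
      moreover have "reg T z = 0" using z0 by (simp only: reg_def)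
      ultimately show ?thesis using that unfolding N_def P_def mem_Collect_eq by metis
    qed
    have P_0: "P 0 = src" and P_T: "P T = snk" using z0 by (simp_all add: P_def src_def snk_def reg_def)
    have P_eq: "P s = P t \<longleftrightarrow> s = t" for s t by (auto simp: P_def)
    have fst_P [simp]: "fst (P t) = t" for t by (simp add: P_def)
    have on_path: "fst u < T" if "u \<in> N - {snk}" "u = P (fst u)" for u
    proof -
      have "fst u \<le> T" using that(1) unfolding N_def by auto
      moreover have "fst u \<noteq> T" using that P_T by auto
      ultimately show ?thesis by simp
    qed
    have dig_P: "dig (P t) (P (Suc t)) = z t" if "t < T" for t
      using \<sigma>\<sigma>[OF that] by (simp add: dig_def P_def reg_def)
    have arc_f: "arc u (f u) \<or> u = f u" if u: "u \<in> N - {snk}" for u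
    proof (cases "u = P (fst u)")
      case True
      then have "arc u (f u)"
        using on_path[OF u True] dig_P[of "fst u"] z[of "fst u"] by (simp add: arc_def f_def) 
      then show ?thesis ..
    qed (simp add: f_def)
    have f_N: "f u \<in> N - {src}" if u: "u \<in> N - {snk}" for u
    proof (cases "u = P (fst u)")
      case True
      then show ?thesis using P_N[of "Suc (fst u)"] on_path[OF u True] by (auto simp: f_def src_def P_def)
    next
      case False
      then show ?thesis using u P_0 by (auto simp: f_def src_def)
    qed
    have f_inj: "u = u'" if u: "u \<in> N - {snk}" and u': "u' \<in> N - {snk}" and eq: "f u = f u'" for u u'
    proof (cases "u = P (fst u)"; cases "u' = P (fst u')")
      assume "u = P (fst u)" "u' = P (fst u')"
      then show ?thesis using eq by (simp add: f_def P_eq)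
    next
      assume 1: "u = P (fst u)" and 2: "u' \<noteq> P (fst u')"
      then have "u' = P (Suc (fst u))" using eq unfolding f_def by simp
      then show ?thesis using 2 by simp
    next
      assume 1: "u \<noteq> P (fst u)" and 2: "u' = P (fst u')"
      then have "u = P (Suc (fst u'))" using eq unfolding f_def by simp
      then show ?thesis using 1 by simp
    next
      assume "u \<noteq> P (fst u)" "u' \<noteq> P (fst u')"
      then show ?thesis using eq by (simp add: f_def)
    qed
    have f_surj: "\<exists>u\<in>N - {snk}. f u = v" if v: "v \<in> N - {src}" for v
    proof (cases "v = P (fst v)")
      case True
      then obtain t where t: "fst v = Suc t" using v P_0 by (cases "fst v") auto
      have "fst v \<le> T" using v unfolding N_def by auto
      then have "P t \<in> N - {snk}" using P_N[of t] t by (auto simp: P_def snk_def)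
      moreover have "f (P t) = v" using True t by (simp add: f_def)
      ultimately show ?thesis by blast
    next
      case False
      then have "v \<in> N - {snk}" using v P_T by (auto simp: snk_def)
      then show ?thesis using False by (auto simp: f_def)
    qed
    have sum_M: "(\<Sum>e\<in>M. h (decode (fst e)) (decode (snd e))) = (\<Sum>t<T. h (P t) (P (Suc t)))"
      if h: "\<And>u. h u u = 0" for h :: "nat \<times> int \<Rightarrow> nat \<times> int \<Rightarrow> real"
    proof -
      have "(\<Sum>e\<in>M. h (decode (fst e)) (decode (snd e))) = (\<Sum>u\<in>N - {snk}. h u (f u))"
        unfolding M_def by (subst sum.reindex) (auto simp: inj_on_def)
      also have "\<dots> = (\<Sum>u\<in>P ` {..<T}. h u (f u))"
      proof (rule sum.mono_neutral_right)
        show "P ` {..<T} \<subseteq> N - {snk}" using P_N by (auto simp: P_def snk_def)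
        show "\<forall>u\<in>N - {snk} - P ` {..<T}. h u (f u) = 0"
        proof
          fix u assume u: "u \<in> N - {snk} - P ` {..<T}"
          then have "u \<noteq> P (fst u)" using on_path by blast
          then show "h u (f u) = 0" using h by (simp add: f_def)
        qed
      qed (use finN in simp)
      also have "\<dots> = (\<Sum>t<T. h (P t) (P (Suc t)))"
        by (subst sum.reindex) (auto simp: inj_on_def P_eq f_def)
      finally show ?thesis .
    qed
    have "perfect_matching H M"
      unfolding perfect_matching_def
    proof (intro conjI)
      show "M \<subseteq> edges H" unfolding M_def EH using arc_f f_N by blast
      show "matching M"
        unfolding matching_def M_def endpoints_def using f_inj by auto
      show "\<forall>v\<in>verts H. \<exists>e\<in>M. v \<in> endpoints e"
      proof
        fix k assume "k \<in> verts H"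
        then consider u where "u \<in> N - {snk}" "k = encode False u" | v where "v \<in> N - {src}" "k = encode True v"
          unfolding verts_def H by blast
        then show "\<exists>e\<in>M. k \<in> endpoints e"
        proof cases
          case 1
          then show ?thesis unfolding M_def endpoints_def by auto
        next
          case 2
          then obtain u where "u \<in> N - {snk}" "f u = v" using f_surj by blast
          then show ?thesis using 2 unfolding M_def endpoints_def by auto
        qed
      qed
    qed
    moreover have "(\<Sum>e\<in>M. edge_reward H e) = (\<Sum>v<T. w v * z v)"
    proof -
      have "(\<Sum>e\<in>M. edge_reward H e) = (\<Sum>t<T. rw (P t) (P (Suc t)))"
        unfolding H by (rule sum_M) (simp add: rw_def)
      also have "\<dots> = (\<Sum>v<T. w v * z v)"
        by (intro sum.cong refl) (use dig_P in \<open>simp add: rw_def\<close>)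
      finally show ?thesis .
    qed
    moreover have "(\<Sum>e\<in>M. edge_cost H e) = (\<Sum>v<T. \<beta> v * (z v)\<^sup>2 + g v * (\<Sum>i\<le>v. \<sigma> i * z i)\<^sup>2)"
    proof -
      have "(\<Sum>e\<in>M. edge_cost H e) = (\<Sum>t<T. co (P t) (P (Suc t)))"
        unfolding H by (rule sum_M) (simp add: co_def)
      also have "\<dots> = (\<Sum>v<T. \<beta> v * (z v)\<^sup>2 + g v * (\<Sum>i\<le>v. \<sigma> i * z i)\<^sup>2)"
      proof (intro sum.cong refl)
        fix v assume "v \<in> {..<T}"
        moreover have "snd (P (Suc v)) = (\<Sum>i\<le>v. \<sigma> i * z i)"
          by (simp only: P_def reg_def snd_conv lessThan_Suc_atMost)
        ultimately show "co (P v) (P (Suc v)) = \<beta> v * (z v)\<^sup>2 + g v * (\<Sum>i\<le>v. \<sigma> i * z i)\<^sup>2"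
          using dig_P by (simp add: co_def)
      qed
      finally show ?thesis .
    qed
    ultimately show ?thesis by blast
  qed
  show ?thesis by (rule that[OF bip rew card_verts pm_below path])
qed

section \<open>Digits, parameters and asymptotics\<close>

lemma digit_sum_strict_mono:
  fixes n c :: nat
  assumes "n \<le> c" "0 < n" "i < j" "j < n ^ K"
  shows "(\<Sum>t<K. c ^ t * (i div n ^ t mod n)) < (\<Sum>t<K. c ^ t * (j div n ^ t mod n))"
  using assms(3,4)
proof (induction K arbitrary: i j)
  case (Suc K)
  define D where "D K i = (\<Sum>t<K. c ^ t * (i div n ^ t mod n))" for K i
  have D: "D (Suc K) i = i mod n + c * D K (i div n)" for i
    unfolding D_def by (subst sum.lessThan_Suc_shift) (simp add: div_mult2_eq sum_distrib_left mult_ac)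
  have IH: "D K i < D K j" if "i < j" "j < n ^ K" for i j
    using Suc.IH[OF that] by (simp add: D_def)
  have "D (Suc K) i < D (Suc K) j"
  proof (cases "i div n = j div n")
    case True
    then have "i mod n < j mod n" using Suc.prems(1) by (metis div_mult_mod_eq nat_add_left_cancel_less)
    then show ?thesis unfolding D True by simp
  next
    case False
    moreover have "i div n \<le> j div n" using Suc.prems(1) by (simp add: div_le_mono)
    moreover have "j div n < n ^ K" using Suc.prems(2) by (simp add: less_mult_imp_div_less mult.commute)
    \<comment> \<open>An increase in the higher digits gains at least \<open>c\<close>, whereas the
      lowest digit can lose at most \<open>n - 1\<close>, which is less than
      \<open>c\<close>.\<close>
    ultimately have "D K (i div n) + 1 \<le> D K (j div n)" using IH[of "i div n" "j div n"] by simp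
    then have "c * D K (i div n) + c \<le> c * D K (j div n)"
      using mult_le_mono2[of "D K (i div n) + 1" "D K (j div n)" c] by (simp only: distrib_left mult_1_right)
    moreover have "i mod n < c" using assms(1,2) by (meson mod_less_divisor order_less_le_trans)
    ultimately show ?thesis unfolding D by linarith
  qed
  then show ?case by (simp only: D_def)
qed simp

text \<open>The choice \<open>n = 2 ^ k\<close> keeps the digit range exponential in
  \<open>k\<close>, as is the number of layers, while the \<open>n ^ k\<close> consistent digit
  choices give \<open>2 ^ (k * k)\<close> touching points. The base 18 collects \<open>3 ^ k\<close>
  layers and a number of registers of order \<open>3 ^ k * 2 ^ k\<close>.\<close>

lemma many_breakpoints_instance:
  assumes k: "0 < k"
  shows "\<exists>(G :: nat reward_graph) \<alpha> Q. card (verts G) \<le> 4 * 18 ^ k \<and> many_breakpoints G (2 ^ (k * k)) \<alpha> Q"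
proof -
  define n :: nat where "n = 2 ^ k"
  have n: "0 < n" by (simp add: n_def)
  show ?thesis
  proof (rule register_program[OF n, of k])
    fix T c :: nat and lev :: "nat \<Rightarrow> nat" and \<sigma> :: "nat \<Rightarrow> int" and w \<beta> g :: "nat \<Rightarrow> real" and q :: real
    assume
      T: "T + 1 = 3 ^ k" and c: "n \<le> c" and q: "0 < q"
      and \<sigma>: "\<And>v. v < T \<Longrightarrow> \<bar>\<sigma> v\<bar> = 1" and w: "\<And>v. 0 \<le> w v"
      and slope: "\<And>y :: nat \<Rightarrow> nat. (\<Sum>v<T. w v * y (lev v)) = q * (\<Sum>t<k. c ^ (k - 1 - t) * y t)"
      and zero: "\<And>y. (\<Sum>v<T. \<sigma> v * y (lev v)) = 0"
      and below: "\<And>z :: nat \<Rightarrow> int. (\<And>v. 0 \<le> z v \<and> z v \<le> int n) \<Longrightarrow>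
        (\<Sum>v<T. w v * z v)\<^sup>2 \<le> (\<Sum>v<T. \<beta> v * (z v)\<^sup>2 + g v * (\<Sum>i\<le>v. \<sigma> i * z i)\<^sup>2)"
      and eq: "\<And>y :: nat \<Rightarrow> int. (\<Sum>v<T. \<beta> v * (y (lev v))\<^sup>2 + g v * (\<Sum>i\<le>v. \<sigma> i * y (lev i))\<^sup>2) =
         (\<Sum>v<T. w v * y (lev v))\<^sup>2"
    have "(3::nat) ^ 1 \<le> 3 ^ k" using k by (intro power_increasing) auto
    then have T0: "0 < T" using T by simp
    show ?thesis
    proof (rule layered_instance[OF T0 \<sigma> w below])
      fix H :: "nat reward_graph"
      assume bip: "bipartite_graph H"
        and rew: "\<And>e. e \<in> edges H \<Longrightarrow> 0 \<le> edge_reward H e"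
        and card: "card (verts H) \<le> 2 * ((T + 1) * (2 * T * n + 1))"
        and pm: "\<And>M. perfect_matching H M \<Longrightarrow> (\<Sum>e\<in>M. edge_reward H e)\<^sup>2 \<le> (\<Sum>e\<in>M. edge_cost H e)"
        and path: "\<And>z :: nat \<Rightarrow> int. (\<And>v. 0 \<le> z v \<and> z v \<le> int n) \<Longrightarrow> (\<Sum>v<T. \<sigma> v * z v) = 0 \<Longrightarrow>
          \<exists>M. perfect_matching H M \<and> (\<Sum>e\<in>M. edge_reward H e) = (\<Sum>v<T. w v * z v) \<and>
            (\<Sum>e\<in>M. edge_cost H e) = (\<Sum>v<T. \<beta> v * (z v)\<^sup>2 + g v * (\<Sum>i\<le>v. \<sigma> i * z i)\<^sup>2)"
      \<comment> \<open>Level 0 is the most significant one, so the digit position runs opposite to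
        the level.\<close>
      define y where "y i t = int (i div n ^ (k - 1 - t) mod n)" for i t
      define p where "p i = q * real (\<Sum>t<k. c ^ t * (i div n ^ t mod n))" for i
      have slope_y: "(\<Sum>v<T. w v * real_of_int (y i (lev v))) = p i" for i
      proof -
        have "(\<Sum>t<k. c ^ (k - Suc t) * (i div n ^ (k - Suc t) mod n)) = (\<Sum>t<k. c ^ t * (i div n ^ t mod n))"
          by (rule sum.nat_diff_reindex)
        then show ?thesis
          using slope[of "\<lambda>t. i div n ^ (k - 1 - t) mod n"] by (simp add: p_def y_def)
      qed
      obtain G \<alpha> Q where G: "verts G = verts H" "many_breakpoints G (2 ^ (k * k)) \<alpha> Q"
      proof (rule normalised_instance[OF bip rew pm, of "2 ^ (k * k)" p])
        have "(2::nat) ^ 1 \<le> 2 ^ (k * k)" using k by (intro power_increasing) auto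
        then show "2 \<le> (2::nat) ^ (k * k)" by simp
        show "0 \<le> p 0" by (simp add: p_def)
        show "p i < p (Suc i)" if "Suc i < 2 ^ (k * k)" for i
        proof -
          have "Suc i < n ^ k" using that by (simp add: n_def power_mult)
          then have "real (\<Sum>t<k. c ^ t * (i div n ^ t mod n)) < real (\<Sum>t<k. c ^ t * (Suc i div n ^ t mod n))"
            using digit_sum_strict_mono[OF c n, of i "Suc i" k] by (simp only: of_nat_less_iff lessI)
          then show ?thesis unfolding p_def using q by (rule mult_strict_left_mono)
        qed
        show "\<exists>M. perfect_matching H M \<and> (\<Sum>e\<in>M. edge_reward H e) = p i \<and> (\<Sum>e\<in>M. edge_cost H e) = (p i)\<^sup>2" for i
        proof -
          have "0 \<le> y i (lev v) \<and> y i (lev v) \<le> int n" for v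
            using n by (simp add: y_def less_imp_le)
          then show ?thesis
            using path[of "\<lambda>v. y i (lev v)"] zero[of "y i"] eq[of "y i"] slope_y[of i] by simp
        qed
      qed (use that in auto)
      have "card (verts H) \<le> 2 * (3 ^ k * (2 * 3 ^ k * n))"
      proof -
        have "2 * T * n + 1 \<le> 2 * (T + 1) * n" using n by (simp add: algebra_simps)
        then have "2 * ((T + 1) * (2 * T * n + 1)) \<le> 2 * ((T + 1) * (2 * (T + 1) * n))"
          by (intro mult_le_mono order_refl)
        then show ?thesis using card unfolding T by linarith
      qed
      also have "\<dots> = 4 * ((3 * 3) ^ k * n)" unfolding power_mult_distrib by simp
      also have "\<dots> = 4 * 18 ^ k" unfolding n_def power_mult_distrib[symmetric] by simp
      finally show ?thesis using G by metis
    qed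
  qed
qed

theorem theorem3:
  "\<exists>(G :: nat \<Rightarrow> nat reward_graph) (m :: nat \<Rightarrow> nat) (\<alpha> :: nat \<Rightarrow> nat \<Rightarrow> real) (Q :: nat \<Rightarrow> real).
     (\<lambda>n. real (card (verts (G n)))) \<in> O(\<lambda>n. real n ^ 4) \<and>
     (\<exists>h \<in> \<Omega>(\<lambda>n. (log 2 (real n))\<^sup>2). \<forall>n. real (m n) = 2 powr h n) \<and>
     (\<forall>n.
        valid_instance (G n) \<and>
        2 \<le> m n \<and> 0 < \<alpha> n 2 \<and> \<alpha> n 2 < Q n \<and>
        (\<forall>e\<in>edges (G n). edge_reward (G n) e \<ge> 0 \<and> edge_cost (G n) e \<ge> 0) \<and>
        (\<forall>S\<subseteq>edges (G n). reward (G n) S \<in> {0..1}) \<and>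
        (\<forall>x\<in>{\<alpha> n 2..Q n}. \<forall>e\<in>edges (G n). edge_weight (G n) x e \<ge> 0) \<and>
        strict_mono_on {2..m n} (\<alpha> n) \<and> \<alpha> n (m n) < Q n \<and>
        (\<forall>p. tie_breaking (G n) p \<longrightarrow>
           (\<forall>i\<in>{2..m n}.
              critical_value (G n) p (\<alpha> n i) \<and>
              max_weight_matching (G n) (edge_weight (G n) (\<alpha> n i)) (demand (G n) p (\<alpha> n i)) \<and>
              perfect_matching (G n) (demand (G n) p (\<alpha> n i))) \<and>
           (\<forall>i\<in>{2..m n}. \<forall>j\<in>{2..m n}. i \<noteq> j \<longrightarrow>
              demand (G n) p (\<alpha> n i) \<noteq> demand (G n) p (\<alpha> n j))))"
proof -
  define l where "l N = nat \<lfloor>log 2 (real N)\<rfloor>" for N :: nat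
  \<comment> \<open>Halving is essential: 18 exceeds 16, so \<open>18 ^ l N\<close> would outgrow
    the fourth power of \<open>N\<close>, whereas \<open>18 ^ (l N div 2)\<close> is safely below
    it. The summand 1 keeps \<open>k N\<close> positive for all \<open>N\<close> and makes
    \<open>2 * k N\<close> at least \<open>l N + 1\<close>, which exceeds the logarithm for
    \<open>N \<ge> 1\<close>.\<close>
  define k where "k N = l N div 2 + 1" for N
  have "\<forall>N. \<exists>(G :: nat reward_graph) \<alpha> Q.
      card (verts G) \<le> 4 * 18 ^ k N \<and> many_breakpoints G (2 ^ (k N * k N)) \<alpha> Q"
    by (intro allI many_breakpoints_instance) (simp add: k_def)
  then obtain G :: "nat \<Rightarrow> nat reward_graph" and \<alpha> Q where
    card: "card (verts (G N)) \<le> 4 * 18 ^ k N" and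
    many: "many_breakpoints (G N) (2 ^ (k N * k N)) (\<alpha> N) (Q N)" for N
    by metis
  have l: "real (l N) \<le> log 2 (real N)" "log 2 (real N) < real (l N) + 1" if "1 \<le> N" for N
  proof -
    have "0 \<le> log 2 (real N)" using that by simp
    then show "real (l N) \<le> log 2 (real N)" "log 2 (real N) < real (l N) + 1"
      unfolding l_def by linarith+
  qed
  have size: "real (card (verts (G N))) \<le> 72 * real N ^ 4" if N: "1 \<le> N" for N
  proof -
    have "(18::real) ^ (l N div 2) \<le> 256 ^ (l N div 2)" by (intro power_mono) auto
    also have "(256::real) ^ (l N div 2) = 16 ^ (2 * (l N div 2))" by (simp add: power_mult)
    also have "\<dots> \<le> 16 ^ l N" by (intro power_increasing) auto
    also have "(16::real) ^ l N = (2 ^ l N) ^ 4"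
      by (subst power_mult[symmetric], subst mult.commute, subst power_mult) simp
    also have "\<dots> \<le> real N ^ 4"
    proof (rule power_mono)
      have "2 powr real (l N) \<le> real N" using l(1)[OF N] N by (simp add: le_log_iff)
      then show "(2::real) ^ l N \<le> real N" by (simp add: powr_realpow)
    qed simp
    finally have "18 ^ (l N div 2) \<le> real N ^ 4" .
    moreover have "real (card (verts (G N))) \<le> real (4 * 18 ^ k N)" using card by (simp only: of_nat_le_iff)
    ultimately show ?thesis by (simp add: k_def)
  qed
  have "(\<lambda>N. real (card (verts (G N)))) \<in> O(\<lambda>N. real N ^ 4)"
    by (rule bigoI[where c = 72], rule eventually_mono[OF eventually_ge_at_top[of 1]]) (use size in auto)
  moreover have "(\<lambda>N. real (k N * k N)) \<in> \<Omega>(\<lambda>N. (log 2 (real N))\<^sup>2)"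
  proof (rule landau_omega.bigI[where c = "1 / 4"], simp, rule eventually_mono[OF eventually_ge_at_top[of 1]])
    fix N :: nat assume N: "1 \<le> N"
    have "l N + 1 \<le> 2 * k N" unfolding k_def by presburger
    then have "log 2 (real N) \<le> 2 * real (k N)" using l(2)[OF N] by linarith
    then have "(log 2 (real N))\<^sup>2 \<le> (2 * real (k N))\<^sup>2" using N by (intro power_mono) auto
    then show "norm (real (k N * k N)) \<ge> 1 / 4 * norm ((log 2 (real N))\<^sup>2)"
      by (simp add: power2_eq_square)
  qed
  moreover have "\<forall>N. real (2 ^ (k N * k N)) = 2 powr real (k N * k N)"
    by (simp add: powr_realpow del: of_nat_mult)
  moreover have "\<forall>e\<in>edges (G N). edge_reward (G N) e \<ge> 0 \<and> edge_cost (G N) e \<ge> 0"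
    "\<forall>S\<subseteq>edges (G N). reward (G N) S \<in> {0..1}" for N
    using many[of N] unfolding many_breakpoints_def valid_instance_def nonneg_edge_data_def normalized_reward_def
    by blast+
  ultimately show ?thesis
    using many unfolding many_breakpoints_def
    by (intro exI[of _ G] exI[of _ "\<lambda>N. 2 ^ (k N * k N)"] exI[of _ \<alpha>] exI[of _ Q]
        conjI bexI[of _ "\<lambda>N. real (k N * k N)"] allI) simp_all
qed

end
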